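(* Let $\{y_t\}$ be generated by $y_{t+1}=\theta^{\tau}\phi(y_t,\ldots,y_{t-n+1})+w_{t+1}$, $t\ge 0$, where $\phi(z_1,\ldots,z_n)=\mathrm{col}\{\phi^{(1)}(z_1),\ldots,\phi^{(n)}(z_n)\}$, and suppose Assumptions A1 and A2 (stated in the context) hold. Let $\hat\theta_t$ be the least squares estimates defined in the context. Then $$\lim_{t\to+\infty}\hat\theta_t=\theta\quad\text{a.s. on }\Big\{\liminf_{t\to+\infty}\|Y_t\|<+\infty\Big\},$$ where $Y_t=(y_{t+n-1},\ldots,y_t)^{\tau}$.
   Context: Setting. $n\ge1$ and $m_1,\ldots,m_n\ge1$ are integers, $m=\sum_{i=1}^n m_i$. For each $i$, $\phi^{(i)}=(f_{i1},\ldots,f_{im_i})^{\tau}:\mathbb{R}\to\mathbb{R}^{m_i}$ is a known Lebesgue measurable function, and $\phi:\mathbb{R}^n\to\mathbb{R}^m$ is obtained by stacking: $\phi(z_1,\ldots,z_n)=\mathrm{col}\{\phi^{(1)}(z_1),\ldots,\phi^{(n)}(z_n)\}$. $\tau$ denotes transpose, $I_m$ the identity matrix. $\theta$ is an $m$-dimensional parameter, $w_t$ are scalar noises, $y_t$ scalar outputs, and $y_t=0$ for $t<0$. Assumption A1. $\{w_t\}$ is an i.i.d. sequence with $w_1\sim N(0,1)$, and $\theta\sim N(\theta_0,I_m)$ is independent of $\{w_t\}$. Assumption A2. There are open sets $E_1,\ldots,E_n\subset\mathbb{R}$ such that (i) $f_{ij}\in C(\mathbb{R})$ and $f_{ij}\in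 C^{m_i}(E_i)$ for $1\le j\le m_i$, $1\le i\le n$; (ii) for every unit vector $x\in\mathbb{R}^m$ there is a point $y\in\prod_{i=1}^nE_i$ such that $|\phi^{\tau}(y)x|\ne0$. Least squares estimates. With $\phi_t=\phi(y_t,\ldots,y_{t-n+1})$, $P_0=I_m$, a deterministic initial condition $\hat\theta_0$, and $\phi_0$ the random initial vector of the system, for $t\ge0$: $$P_{t+1}=P_t-(1+\phi_t^{\tau}P_t\phi_t)^{-1}P_t\phi_t\phi_t^{\tau}P_t,\qquad \hat\theta_{t+1}=\hat\theta_t+P_{t+1}\phi_t(y_{t+1}-\phi_t^{\tau}\hat\theta_t).$$
   Formalization: The formal statement adds that the pair (θ, y_0) is jointly independent of the noises w_1, w_2, …; the initial value y_0 may be random and may depend on θ, but not on future noise, since for an anticipating y_0 the claim can fail. *)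

theory Defs
  imports "HOL-Probability.Probability"
begin

definition Ck_on :: "nat \<Rightarrow> (real \<Rightarrow> real) \<Rightarrow> real set \<Rightarrow> bool" where
  "Ck_on k f E \<longleftrightarrow>
     (\<forall>j<k. \<forall>x\<in>E. (deriv ^^ j) f field_differentiable (at x)) \<and>
     (\<forall>j\<le>k. continuous_on E ((deriv ^^ j) f))"

text \<open>
  A coordinate of \<open>\<real>\<^sup>m\<close>, with \<open>m = m\<^sub>1 + \<dots> + m\<^sub>n\<close>, is a pair \<open>(i, j)\<close> (block \<open>i\<close>, position \<open>j\<close>
  inside the block). The finite index type \<open>'m\<close> is identified with the set of these pairs through
  a bijection \<open>pos\<close>, so coordinate \<open>k\<close> with \<open>pos k = (i, j)\<close> carries \<open>f\<^sub>i\<^sub>j(z\<^sub>i)\<close>.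
\<close>

definition block_indices :: "nat \<Rightarrow> (nat \<Rightarrow> nat) \<Rightarrow> (nat \<times> nat) set" where
  "block_indices n ms = (SIGMA i:{1..n}. {1..ms i})"

definition col :: "('m \<Rightarrow> nat \<times> nat) \<Rightarrow> (nat \<Rightarrow> nat \<Rightarrow> real \<Rightarrow> real) \<Rightarrow> (nat \<Rightarrow> real) \<Rightarrow> real ^ 'm::finite"
  where "col pos f z = (\<chi> k. case pos k of (i, j) \<Rightarrow> f i j (z i))"

text \<open>\<open>lag y t i\<close> is \<open>y\<^bsub>t-i+1\<^esub>\<close>, so that \<open>lag y t\<close> on \<open>{1..n}\<close> is \<open>(y\<^sub>t, \<dots>, y\<^bsub>t-n+1\<^esub>)\<close>.\<close>

definition lag :: "(int \<Rightarrow> real) \<Rightarrow> int \<Rightarrow> nat \<Rightarrow> real" where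
  "lag y t i = y (t - int i + 1)"

definition normal_vec_density :: "real ^ 'm::finite \<Rightarrow> real ^ 'm \<Rightarrow> real" where
  "normal_vec_density \<mu> x =
     (2 * pi) powr (- (real CARD('m) / 2)) * exp (- (norm (x - \<mu>))\<^sup>2 / 2)"

text \<open>Unlike \<open>prob_space.indep_var\<close>, the two random elements may have values in different types.\<close>

definition indep_elements ::
  "'a measure \<Rightarrow> 'b measure \<Rightarrow> ('a \<Rightarrow> 'b) \<Rightarrow> 'c measure \<Rightarrow> ('a \<Rightarrow> 'c) \<Rightarrow> bool" where
  "indep_elements M S X T Y \<longleftrightarrow>
     X \<in> measurable M S \<and> Y \<in> measurable M T \<and>
     prob_space.indep_set M (sets (vimage_algebra (space M) X S))
                            (sets (vimage_algebra (space M) Y T))"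

primrec ls_P :: "(nat \<Rightarrow> real ^ 'm::finite) \<Rightarrow> nat \<Rightarrow> real ^ 'm ^ 'm" where
  "ls_P \<phi> 0 = mat 1"
| "ls_P \<phi> (Suc t) = ls_P \<phi> t -
     inverse (1 + \<phi> t \<bullet> (ls_P \<phi> t *v \<phi> t)) *\<^sub>R
       (ls_P \<phi> t ** (columnvector (\<phi> t) :: real ^ 1 ^ 'm) ** rowvector (\<phi> t) ** ls_P \<phi> t)"

primrec ls_estimate ::
  "real ^ 'm \<Rightarrow> (nat \<Rightarrow> real ^ 'm::finite) \<Rightarrow> (nat \<Rightarrow> real) \<Rightarrow> nat \<Rightarrow> real ^ 'm" where
  "ls_estimate \<theta>h0 \<phi> y 0 = \<theta>h0"
| "ls_estimate \<theta>h0 \<phi> y (Suc t) = ls_estimate \<theta>h0 \<phi> y t +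
     (y (Suc t) - \<phi> t \<bullet> ls_estimate \<theta>h0 \<phi> y t) *\<^sub>R (ls_P \<phi> (Suc t) *v \<phi> t)"

end

theory Submission imports Defs begin

text \<open>
  Under a Gaussian prior for \<open>\<theta>\<close> and a past that is independent of \<open>\<theta>\<close>, the posterior given the outputs
  up to time \<open>t\<close> is Gaussian, centred at the least squares estimate, with precision \<open>P\<^sub>t\<^sup>-\<^sup>1\<close>. It is
  symmetric about the estimate, which gives a maximal inequality by reflection, and the
  posterior mean of \<open>(\<theta> - \<theta>\<^sub>t) \<bullet> P\<^sub>t\<^sup>-\<^sup>1 (\<theta> - \<theta>\<^sub>t)\<close> is bounded by a constant. Together they yield
  \<open>\<theta>\<^sub>t \<longlonglongrightarrow> \<theta>\<close> almost surely where the least eigenvalue of \<open>P\<^sub>t\<^sup>-\<^sup>1\<close> tends to infinity.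

  The initial output may depend on \<open>\<theta>\<close>. However, it is forgotten after \<open>n\<close> steps, and the law of
  \<open>(\<theta>, y\<^sub>1, \<dots>, y\<^sub>n, w\<^sub>n\<^sub>+\<^sub>1, \<dots>)\<close> is absolutely continuous with respect to the product of the prior
  and the noise law, so almost sure statements carry over; restarting least squares at time \<open>n\<close>
  does not change the limit.

  Where the outputs return to a bounded set infinitely often, the Gaussian noise makes the
  window \<open>(y\<^sub>t, \<dots>, y\<^bsub>t-n+1\<^esub>)\<close> visit every open set infinitely often. By compactness of the unit
  sphere, finitely many open sets suffice to excite all directions, so the least eigenvalue
  tends to infinity.
\<close>

subsection \<open>Algebra of the least squares recursion\<close>

text \<open>This is \<open>P_t^{-1}\<close>, the information matrix
  \<open>I + \<Sum> \<phi>_s \<phi>_s^T\<close>, kept as an operator so that no matrix inverse has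
  to be formed; \<open>info_form\<close> is its quadratic form.\<close>

definition info_op :: "(nat \<Rightarrow> real ^ 'm::finite) \<Rightarrow> nat \<Rightarrow> real ^ 'm \<Rightarrow> real ^ 'm" where
  "info_op \<phi> t u = u + (\<Sum>s<t. (\<phi> s \<bullet> u) *\<^sub>R \<phi> s)"

definition info_form :: "(nat \<Rightarrow> real ^ 'm::finite) \<Rightarrow> nat \<Rightarrow> real ^ 'm \<Rightarrow> real" where
  "info_form \<phi> t u = (norm u)\<^sup>2 + (\<Sum>s<t. (\<phi> s \<bullet> u)\<^sup>2)"

lemma info_op_0 [simp]: "info_op \<phi> 0 u = u"
  by (simp add: info_op_def)

lemma info_op_Suc: "info_op \<phi> (Suc t) u = info_op \<phi> t u + (\<phi> t \<bullet> u) *\<^sub>R \<phi> t"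
  by (simp add: info_op_def)

lemma linear_info_op: "linear (info_op \<phi> t)"
  unfolding info_op_def
  by (rule linearI) (simp_all add: inner_add_right scaleR_add_left scaleR_add_right sum.distrib scaleR_sum_right)

lemma inner_info_op: "u \<bullet> info_op \<phi> t u = info_form \<phi> t u"
  by (simp add: info_op_def info_form_def inner_add_right inner_sum_right power2_norm_eq_inner
      inner_commute[of u "\<phi> _"] power2_eq_square[of "_ \<bullet> _"])

lemma inner_info_op_commute: "a \<bullet> info_op \<phi> t b = b \<bullet> info_op \<phi> t a"
  by (simp add: info_op_def inner_add_right inner_sum_right inner_commute mult.commute)

lemma info_form_nonneg: "0 \<le> info_form \<phi> t u"
  by (simp add: info_form_def sum_nonneg)

lemma info_form_scaleR: "info_form \<phi> t (c *\<^sub>R u) = c\<^sup>2 * info_form \<phi> t u"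
  by (simp add: info_form_def power_mult_distrib distrib_left sum_distrib_left)

lemma info_form_minus: "info_form \<phi> t (- u) = info_form \<phi> t u"
  by (simp add: info_form_def)

lemma info_form_diff:
  "info_form \<phi> t (a - b) = info_form \<phi> t a - 2 * (a \<bullet> info_op \<phi> t b) + info_form \<phi> t b"
  using inner_info_op_commute[of a \<phi> t b]
  by (simp add: inner_info_op[symmetric] linear_diff[OF linear_info_op] inner_diff_left inner_diff_right)

section \<open>Least squares as the solution of the normal equations\<close>

lemma ls_P_Suc_mult:
  "ls_P \<phi> (Suc t) *v v = ls_P \<phi> t *v v -
     (inverse (1 + \<phi> t \<bullet> (ls_P \<phi> t *v \<phi> t)) * (\<phi> t \<bullet> (ls_P \<phi> t *v v))) *\<^sub>R (ls_P \<phi> t *v \<phi> t)"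
proof -
  have row: "((rowvector a :: real ^ 'm ^ 1) *v b) $ 1 = a \<bullet> b" for a b :: "real ^ 'm"
    by (simp add: matrix_vector_mult_def rowvector_def inner_vec_def)
  have col: "(columnvector a :: real ^ 1 ^ 'm) *v r = (r $ 1) *\<^sub>R a" for a :: "real ^ 'm" and r
    by (simp add: matrix_vector_mult_def columnvector_def vec_eq_iff UNIV_1)
  show ?thesis
    by (simp add: matrix_vector_mult_diff_rdistrib scaleR_matrix_vector_assoc[symmetric]
        matrix_vector_mul_assoc[symmetric] row col matrix_vector_mult_scaleR)
qed

text \<open>Sherman-Morrison formula: the correction term of \<open>ls_P\<close> inverts a rank one
  update of the information matrix, so the two recursions stay inverse to each other.\<close>

lemma info_op_ls_P: "info_op \<phi> t (ls_P \<phi> t *v v) = v"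
proof (induction t arbitrary: v)
  case 0
  then show ?case by simp
next
  case (Suc t)
  let ?P = "ls_P \<phi> t" and ?A = "info_op \<phi> t" and ?h = "\<phi> t"
  define r where "r = ?h \<bullet> (?P *v ?h)"
  define a where "a = ?h \<bullet> (?P *v v)"
  \<comment> \<open>By induction \<open>r\<close> is the value of the information form at
    \<open>?P *v ?h\<close>, hence nonnegative, and \<open>1 + r\<close> can be divided by.\<close>
  have "r = (?P *v ?h) \<bullet> ?A (?P *v ?h)"
    unfolding Suc.IH r_def by (simp add: inner_commute)
  then have r: "0 \<le> r"
    by (simp add: inner_info_op info_form_nonneg)
  have "info_op \<phi> (Suc t) (ls_P \<phi> (Suc t) *v v) =
      v - (inverse (1 + r) * a) *\<^sub>R ?h + (a - inverse (1 + r) * a * r) *\<^sub>R ?h"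
    unfolding info_op_Suc ls_P_Suc_mult linear_diff[OF linear_info_op] linear_cmul[OF linear_info_op]
      Suc.IH inner_diff_right
    by (simp add: r_def a_def scaleR_diff_left scaleR_add_right scaleR_scaleR)
  also have "\<dots> = v + (a - inverse (1 + r) * a * (1 + r)) *\<^sub>R ?h"
    by (simp add: algebra_simps)
  also have "a - inverse (1 + r) * a * (1 + r) = 0"
    using r by (simp add: field_simps)
  finally show ?case by simp
qed

text \<open>The normal equations. Applying the information matrix cancels the gain
  \<open>P_{t+1}\<close>, and what remains of the recursion adds one term
  \<open>y_{t+1} \<phi>_t\<close> per step.\<close>

lemma info_op_ls_estimate:
  "info_op \<phi> t (ls_estimate \<theta>h0 \<phi> y t) = \<theta>h0 + (\<Sum>s<t. y (Suc s) *\<^sub>R \<phi> s)"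
proof (induction t)
  case (Suc t)
  let ?e = "ls_estimate \<theta>h0 \<phi> y t"
  have "info_op \<phi> (Suc t) (ls_estimate \<theta>h0 \<phi> y (Suc t)) =
      info_op \<phi> (Suc t) ?e + (y (Suc t) - \<phi> t \<bullet> ?e) *\<^sub>R \<phi> t"
    by (simp only: ls_estimate.simps linear_add[OF linear_info_op] linear_cmul[OF linear_info_op]
        info_op_ls_P)
  then show ?case
    by (simp add: info_op_Suc Suc.IH algebra_simps)
qed simp

text \<open>With \<open>A\<close> the information operator, Cauchy-Schwarz gives
  \<open>K |u|^2 \<le> u \<bullet> A u \<le> |u| |A u|\<close>.\<close>

lemma norm_le_of_info_form:
  assumes "K > 0" and "K * (norm u)\<^sup>2 \<le> info_form \<phi> t u"
  shows "norm u \<le> norm (info_op \<phi> t u) / K"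
proof (cases "u = 0")
  case False
  have "K * norm u * norm u \<le> norm (info_op \<phi> t u) * norm u"
    using assms(2) norm_cauchy_schwarz[of u "info_op \<phi> t u"]
    by (simp add: inner_info_op power2_eq_square mult.assoc mult.commute[of "norm (info_op \<phi> t u)"] mult.left_commute[of "norm u" K])
  then show ?thesis
    using False assms(1) by (simp add: field_simps)
qed (use assms in simp)

text \<open>Discarding finitely many regressors and changing the initial value changes
  \<open>info_op\<close> applied to the estimate only by a bounded amount.\<close>

lemma ls_estimate_restart:
  fixes \<phi> \<psi> :: "nat \<Rightarrow> real ^ 'm::finite"
  assumes late: "\<And>s. s \<ge> n \<Longrightarrow> \<psi> s = \<phi> s" and early: "\<And>s. s < n \<Longrightarrow> \<psi> s = 0"
    and lim: "(\<lambda>t. ls_estimate a \<psi> y t) \<longlonglongrightarrow> \<theta>"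
    and exc: "\<And>K. \<forall>\<^sub>F t in sequentially. \<forall>u. K * (norm u)\<^sup>2 \<le> info_form \<psi> t u"
  shows "(\<lambda>t. ls_estimate b \<phi> y t) \<longlonglongrightarrow> \<theta>"
proof -
  let ?X = "ls_estimate a \<psi> y" and ?Z = "ls_estimate b \<phi> y"
  \<comment> \<open>\<open>C\<close> is the share of the first \<open>n\<close> regressors in the
    information matrix; \<open>c\<close> is their share in the right-hand side of the normal
    equations plus the change of initial value.\<close>
  define C where "C u = (\<Sum>s<n. (\<phi> s \<bullet> u) *\<^sub>R \<phi> s)" for u
  define c where "c = b - a + (\<Sum>s<n. y (Suc s) *\<^sub>R \<phi> s)"
  have split: "(\<Sum>s<t. F s) = (\<Sum>s<n. F s) + (\<Sum>s\<in>{n..<t}. F s)" if "n \<le> t"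
    for F :: "nat \<Rightarrow> real ^ 'm" and t
    using that by (metis lessThan_atLeast0 sum.atLeastLessThan_concat zero_le)
  have op: "info_op \<phi> t u = info_op \<psi> t u + C u" if "n \<le> t" for t u
    unfolding info_op_def C_def split[OF that]
    by (simp add: early late)
  have diff: "info_op \<phi> t (?Z t - ?X t) = c - C (?X t)" if "n \<le> t" for t
  proof -
    have "info_op \<phi> t (?Z t) = c + info_op \<psi> t (?X t)"
      unfolding info_op_ls_estimate c_def split[OF that]
      by (simp add: early late)
    then show ?thesis
      using op[OF that] by (simp add: linear_diff[OF linear_info_op])
  qed
  have contC: "continuous_on UNIV C"
    unfolding C_def by (intro continuous_intros)
  have "(\<lambda>t. norm (c - C (?X t))) \<longlonglongrightarrow> norm (c - C \<theta>)"
    by (intro tendsto_intros continuous_on_tendsto_compose[OF contC lim]) auto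
  then have bnd: "\<forall>\<^sub>F t in sequentially. norm (c - C (?X t)) < norm (c - C \<theta>) + 1"
    by (rule order_tendstoD) simp
  have "(\<lambda>t. ?Z t - ?X t) \<longlonglongrightarrow> 0"
    unfolding tendsto_iff
  proof (intro allI impI)
    fix e :: real assume e: "e > 0"
    \<comment> \<open>Chosen so that the eventual bound on \<open>norm (c - C (?X t))\<close>,
      divided by \<open>K\<close>, is below \<open>e\<close>; the last summand \<open>1\<close>
      makes this strict.\<close>
    define K where "K = (norm (c - C \<theta>) + 1) / e + 1"
    have K: "K > 0" using e unfolding K_def by (intro add_nonneg_pos divide_nonneg_pos) auto
    have "(norm (c - C \<theta>) + 1) = e * (K - 1)"
      using e by (simp add: K_def)
    then have small: "(norm (c - C \<theta>) + 1) / K < e"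
      using e K by (simp add: field_simps)
    show "\<forall>\<^sub>F t in sequentially. dist (?Z t - ?X t) 0 < e"
      using bnd exc[of K] eventually_ge_at_top[of n]
    proof eventually_elim
      case (elim t)
      have "info_form \<psi> t u \<le> info_form \<phi> t u" for u
        unfolding info_form_def by (intro add_left_mono sum_mono) (metis early late inner_zero_left le_less_linear order_refl power_zero_numeral zero_le_power2)
      then have "K * (norm (?Z t - ?X t))\<^sup>2 \<le> info_form \<phi> t (?Z t - ?X t)"
        using elim(2) order_trans by blast
      then have "norm (?Z t - ?X t) \<le> norm (info_op \<phi> t (?Z t - ?X t)) / K"
        by (rule norm_le_of_info_form[OF K])
      also have "\<dots> \<le> (norm (c - C \<theta>) + 1) / K"
        using elim K by (intro divide_right_mono) (auto simp: diff)
      finally show ?case using small by simp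
    qed
  qed
  from tendsto_add[OF this lim] show ?thesis by simp
qed

subsection \<open>Gaussian noise sequences and the paths they drive\<close>

definition gauss :: "real measure" where
  "gauss = density lborel (\<lambda>x. ennreal (std_normal_density x))"

text \<open>Time starts at \<open>1\<close>, the index of the first noise. Points of this product
  space therefore take the default value \<open>undefined\<close> at \<open>0\<close>.\<close>

definition noise :: "(nat \<Rightarrow> real) measure" where
  "noise = PiM {1..} (\<lambda>_. gauss)"

lemma sets_gauss [measurable_cong, simp]: "sets gauss = sets borel"
  by (simp add: gauss_def)

lemma space_gauss [simp]: "space gauss = UNIV"
  by (simp add: gauss_def)

lemma prob_space_gauss: "prob_space gauss"
  unfolding gauss_def by (rule prob_space_normal_density) simp

lemma sets_noise [measurable_cong]: "sets noise = sets (PiM {1..} (\<lambda>_. borel))"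
  unfolding noise_def by (rule sets_PiM_cong) auto

lemma space_noise: "space noise = PiE {1..} (\<lambda>_. UNIV)"
  by (simp add: noise_def space_PiM)

lemma prob_space_noise: "prob_space noise"
  unfolding noise_def by (intro prob_space_PiM prob_space_gauss)

lemma measurable_noise_upd [measurable (raw)]:
  assumes "k \<in> {1..}" "f \<in> measurable M noise" "h \<in> borel_measurable M"
  shows "(\<lambda>x. (f x)(k := h x)) \<in> measurable M noise"
proof -
  have "(\<lambda>x. (f x)(k := h x)) \<in> measurable M (PiM {1..} (\<lambda>_. borel))"
    using assms by (intro measurable_fun_upd[where J="{1..}"]) (auto simp: measurable_cong_sets[OF refl sets_noise])
  then show ?thesis
    by (simp add: measurable_cong_sets[OF refl sets_noise])
qed

lemma measurable_noise_component [measurable (raw)]: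
  assumes "k \<in> {1..}" "f \<in> measurable M noise"
  shows "(\<lambda>x. f x k) \<in> borel_measurable M"
  using assms(2) measurable_compose[OF _ measurable_component_singleton[OF assms(1), where M="\<lambda>_. borel"]]
  by (auto simp: measurable_cong_sets[OF refl sets_noise])

text \<open>Coordinate \<open>k\<close> is independent of the others, so overwriting it by a fresh
  copy preserves the law. This replaces conditioning on all noises except the
  \<open>k\<close>-th.\<close>

lemma nn_integral_noise_resample:
  assumes [measurable]: "f \<in> borel_measurable noise" and k: "k \<ge> 1"
  shows "(\<integral>\<^sup>+v. f v \<partial>noise) = (\<integral>\<^sup>+v. \<integral>\<^sup>+a. f (v(k := a)) \<partial>gauss \<partial>noise)"
proof -
  let ?I = "{1..} - {k}" and ?J = "PiM ({1..} - {k}) (\<lambda>_. gauss)"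
  interpret G: prob_space gauss by (rule prob_space_gauss)
  interpret J: prob_space ?J by (intro prob_space_PiM prob_space_gauss)
  interpret P: pair_sigma_finite gauss ?J ..
  have ins: "insert k ?I = {1..}" using k by auto
  have noise: "noise = distr (gauss \<Otimes>\<^sub>M ?J) noise (\<lambda>(x, X). X(k := x))"
    using distr_pair_PiM_eq_PiM[of ?I "\<lambda>_. gauss" k] prob_space_gauss
    unfolding ins noise_def by auto
  have upd: "(\<lambda>(x, X). X(k := x)) \<in> measurable (gauss \<Otimes>\<^sub>M ?J) noise"
    unfolding noise_def case_prod_beta
    by (intro measurable_fun_upd[where J="?I"]) (use k in auto)
  have int: "(\<integral>\<^sup>+v. h v \<partial>noise) = (\<integral>\<^sup>+X. \<integral>\<^sup>+x. h (X(k := x)) \<partial>gauss \<partial>?J)"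
    if [measurable]: "h \<in> borel_measurable noise" for h
  proof -
    have m: "(\<lambda>(x, X). h (X(k := x))) \<in> borel_measurable (gauss \<Otimes>\<^sub>M ?J)"
      using measurable_compose[OF upd that] by (simp add: case_prod_beta)
    have "(\<integral>\<^sup>+v. h v \<partial>noise) = (\<integral>\<^sup>+z. (case z of (x, X) \<Rightarrow> h (X(k := x))) \<partial>(gauss \<Otimes>\<^sub>M ?J))"
      by (subst noise, subst nn_integral_distr[OF upd]) (auto simp: case_prod_beta')
    then show ?thesis
      using P.nn_integral_snd[OF m] by simp
  qed
  have [measurable]: "k \<in> {1..}" using k by simp
  have "(\<integral>\<^sup>+v. \<integral>\<^sup>+a. f (v(k := a)) \<partial>gauss \<partial>noise) =
      (\<integral>\<^sup>+X. \<integral>\<^sup>+x. \<integral>\<^sup>+a. f ((X(k := x))(k := a)) \<partial>gauss \<partial>gauss \<partial>?J)"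
    by (rule int) measurable
  also have "\<dots> = (\<integral>\<^sup>+v. f v \<partial>noise)"
    by (simp add: int G.emeasure_space_1[simplified])
  finally show ?thesis by simp
qed

lemma nn_integral_resample:
  assumes [measurable]: "f \<in> borel_measurable (\<rho> \<Otimes>\<^sub>M noise)" and k: "k \<ge> 1"
  shows "(\<integral>\<^sup>+z. f z \<partial>(\<rho> \<Otimes>\<^sub>M noise)) =
    (\<integral>\<^sup>+z. \<integral>\<^sup>+a. f (fst z, (snd z)(k := a)) \<partial>gauss \<partial>(\<rho> \<Otimes>\<^sub>M noise))"
proof -
  interpret N: prob_space noise by (rule prob_space_noise)
  interpret G: prob_space gauss by (rule prob_space_gauss)
  have [measurable]: "k \<in> {1..}" using k by simp
  have "(\<integral>\<^sup>+v. f (p, v) \<partial>noise) = (\<integral>\<^sup>+v. \<integral>\<^sup>+a. f (p, v(k := a)) \<partial>gauss \<partial>noise)"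
    if "p \<in> space \<rho>" for p
    using that by (intro nn_integral_noise_resample k) measurable
  then show ?thesis
    by (simp add: N.nn_integral_fst[symmetric] cong: nn_integral_cong)
qed

text \<open>One-dimensional Cameron-Martin formula, from expanding the square in the shifted
  Gaussian density.\<close>

lemma nn_integral_gauss_shift:
  assumes [measurable]: "F \<in> borel_measurable borel"
  shows "(\<integral>\<^sup>+a. F (a + c) \<partial>gauss) = (\<integral>\<^sup>+a. F a * ennreal (exp (c * a - c\<^sup>2 / 2)) \<partial>gauss)"
proof -
  have dens: "std_normal_density (a - c) = std_normal_density a * exp (c * a - c\<^sup>2 / 2)" for a
    by (simp add: std_normal_density_def exp_add[symmetric] power2_eq_square field_simps)
  have "(\<integral>\<^sup>+a. F (a + c) \<partial>gauss) = (\<integral>\<^sup>+a. ennreal (std_normal_density a) * F (a + c) \<partial>lborel)"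
    unfolding gauss_def by (subst nn_integral_density) auto
  also have "\<dots> = (\<integral>\<^sup>+a. ennreal (std_normal_density (a - c)) * F a \<partial>lborel)"
    by (subst nn_integral_real_affine[where c=1 and t="- c"]) auto
  also have "\<dots> = (\<integral>\<^sup>+a. F a * ennreal (exp (c * a - c\<^sup>2 / 2)) \<partial>gauss)"
    unfolding gauss_def dens
    by (subst nn_integral_density) (auto simp: ennreal_mult mult_ac intro!: nn_integral_cong)
  finally show ?thesis .
qed

section \<open>Nonanticipating drifts and the paths they produce from the noise\<close>

definition adapted :: "(nat \<Rightarrow> (nat \<Rightarrow> real) \<Rightarrow> 'b) \<Rightarrow> bool" where
  "adapted h \<longleftrightarrow> (\<forall>t x x'. (\<forall>s\<le>t. x s = x' s) \<longrightarrow> h t x = h t x')"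

lemma adaptedD: "adapted h \<Longrightarrow> (\<And>s. s \<le> t \<Longrightarrow> x s = x' s) \<Longrightarrow> h t x = h t x'"
  by (auto simp: adapted_def)

lemma adapted_upd: "adapted h \<Longrightarrow> t < k \<Longrightarrow> h t (x(k := a)) = h t x"
  by (rule adaptedD) auto

text \<open>After \<open>t\<close> steps the coordinates \<open>1..t\<close> hold outputs and the
  later ones still hold raw noise. Each step changes exactly one coordinate of a full sequence,
  which the induction in \<open>path_law\<close> relies on.\<close>

primrec drift_path :: "(nat \<Rightarrow> 'p \<Rightarrow> (nat \<Rightarrow> real) \<Rightarrow> real) \<Rightarrow> 'p \<Rightarrow> (nat \<Rightarrow> real) \<Rightarrow> nat \<Rightarrow> nat \<Rightarrow> real" where
  "drift_path g p v 0 = v"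
| "drift_path g p v (Suc t) = (drift_path g p v t)(Suc t := drift_path g p v t (Suc t) + g t p (drift_path g p v t))"

definition traj :: "(nat \<Rightarrow> 'p \<Rightarrow> (nat \<Rightarrow> real) \<Rightarrow> real) \<Rightarrow> 'p \<Rightarrow> (nat \<Rightarrow> real) \<Rightarrow> nat \<Rightarrow> real" where
  "traj g p v t = drift_path g p v t t"

lemma path_later: "t < s \<Longrightarrow> drift_path g p v t s = v s"
  by (induction t) auto

lemma path_eq_traj: "s \<le> t \<Longrightarrow> drift_path g p v t s = traj g p v s"
proof (induction t)
  case (Suc t)
  then show ?case by (cases "s = Suc t") (auto simp: traj_def)
qed (simp add: traj_def)

lemma adapted_path: "adapted h \<Longrightarrow> t \<le> T \<Longrightarrow> h t (drift_path g p v T) = h t (traj g p v)"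
  by (rule adaptedD) (auto simp: path_eq_traj)

lemma traj_Suc:
  assumes "adapted (\<lambda>t. g t p)"
  shows "traj g p v (Suc t) = v (Suc t) + g t p (traj g p v)"
  using adapted_path[OF assms order_refl] by (simp add: traj_def[of _ _ _ "Suc t"] path_later)

lemma path_upd:
  assumes "adapted (\<lambda>t. g t p)"
  shows "t < k \<Longrightarrow> drift_path g p (v(k := a)) t = (drift_path g p v t)(k := a)"
  by (induction t) (auto simp: adapted_upd[OF assms] fun_upd_twist)

lemma adapted_traj_upd:
  assumes "adapted (\<lambda>t. g t p)" "adapted h" "t < k"
  shows "h t (traj g p (v(k := a))) = h t (traj g p v)"
  unfolding adapted_path[OF assms(2) order_refl, symmetric] path_upd[where g=g and p=p, OF assms(1,3)]
  by (rule adapted_upd[OF assms(2,3)])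

text \<open>\<open>\<rho>\<close> is the law of everything drawn before the noise; independence from
  the noise is built into the product measure \<open>K\<close>.\<close>

locale noise_driven = prob_space \<rho> for \<rho> :: "'p measure" +
  fixes g :: "nat \<Rightarrow> 'p \<Rightarrow> (nat \<Rightarrow> real) \<Rightarrow> real"
  assumes drift_measurable: "\<And>t. (\<lambda>z. g t (fst z) (snd z)) \<in> borel_measurable (\<rho> \<Otimes>\<^sub>M noise)"
    and drift_adapted: "\<And>p. adapted (\<lambda>t. g t p)"
begin

abbreviation K where "K \<equiv> \<rho> \<Otimes>\<^sub>M noise"

sublocale N: prob_space noise by (rule prob_space_noise)
sublocale KP: pair_prob_space \<rho> noise ..
sublocale G: prob_space gauss by (rule prob_space_gauss)

lemma measurable_drift [measurable (raw)]:
  assumes "a \<in> measurable M \<rho>" "b \<in> measurable M noise"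
  shows "(\<lambda>x. g t (a x) (b x)) \<in> borel_measurable M"
  using measurable_compose[OF measurable_Pair[OF assms] drift_measurable[of t]] by simp

lemma measurable_path [measurable (raw)]:
  assumes [measurable]: "a \<in> measurable M \<rho>" "b \<in> measurable M noise"
  shows "(\<lambda>x. drift_path g (a x) (b x) t) \<in> measurable M noise"
proof (induction t)
  case (Suc t)
  note [measurable] = Suc.IH
  have [measurable]: "Suc t \<in> {1..}" by simp
  show ?case unfolding drift_path.simps by measurable
qed simp

lemma measurable_traj_at:
  assumes [measurable]: "k \<in> {1..}" "a \<in> measurable M \<rho>" "b \<in> measurable M noise"
  shows "(\<lambda>x. traj g (a x) (b x) k) \<in> borel_measurable M"
  unfolding traj_def by measurable

lemma measurable_traj [measurable (raw)]:
  assumes [measurable]: "a \<in> measurable M \<rho>" "b \<in> measurable M noise"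
  shows "(\<lambda>x. traj g (a x) (b x)) \<in> measurable M noise"
proof -
  have "(\<lambda>x. \<lambda>k\<in>{1..}. traj g (a x) (b x) k) \<in> measurable M (PiM {1..} (\<lambda>_. borel))"
    by (intro measurable_restrict measurable_traj_at) measurable
  also have "?this \<longleftrightarrow> (\<lambda>x. traj g (a x) (b x)) \<in> measurable M (PiM {1..} (\<lambda>_. borel))"
  proof (rule measurable_cong)
    \<comment> \<open>The recursion never overwrites coordinate \<open>0\<close>, so the trajectory
      has the default value there and agrees with its restriction to \<open>{1..}\<close>.\<close>
    fix x assume "x \<in> space M"
    then have "b x \<in> space noise" by (rule measurable_space[OF assms(2)])
    then have "b x 0 = undefined" by (auto simp: space_noise)
    then show "(\<lambda>k\<in>{1..}. traj g (a x) (b x) k) = traj g (a x) (b x)"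
      by (auto simp: restrict_def traj_def fun_eq_iff not_less_eq_eq)
  qed
  finally show ?thesis
    by (simp add: measurable_cong_sets[OF refl sets_noise])
qed

text \<open>A discrete Girsanov formula: each step shifts one Gaussian coordinate by a drift fixed
  by the past, and \<open>nn_integral_gauss_shift\<close> contributes one factor of the likelihood
  ratio.\<close>

lemma path_law:
  assumes "F \<in> borel_measurable K"
  shows "(\<integral>\<^sup>+z. F (fst z, drift_path g (fst z) (snd z) T) \<partial>K) =
    (\<integral>\<^sup>+z. F z * ennreal (exp (\<Sum>s<T. g s (fst z) (snd z) * snd z (Suc s) - (g s (fst z) (snd z))\<^sup>2 / 2)) \<partial>K)"
  using assms
proof (induction T arbitrary: F)
  case 0
  then show ?case by simp
next
  case (Suc T)
  note [measurable] = Suc.prems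
  let ?c = "\<lambda>z. g T (fst z) (snd z)"
  let ?l = "\<lambda>z. exp (\<Sum>s<T. g s (fst z) (snd z) * snd z (Suc s) - (g s (fst z) (snd z))\<^sup>2 / 2)"
  let ?R = "\<lambda>z. F z * ennreal (?l z) * ennreal (exp (?c z * snd z (Suc T) - (?c z)\<^sup>2 / 2))"
  have k[measurable]: "Suc s \<in> {1..}" for s by simp
  \<comment> \<open>Neither the drifts up to time \<open>T\<close> nor the likelihood of the earlier
    steps sees coordinate \<open>Suc T\<close>, so both are constants while that coordinate is
    resampled.\<close>
  have c: "g s p (v(Suc T := a)) = g s p v" if "s \<le> T" for s p v a
    using that by (intro adapted_upd[OF drift_adapted]) auto
  have l: "?l (p, v(Suc T := a)) = ?l (p, v)" for p v a
    by (intro arg_cong[where f=exp] sum.cong) (auto simp: c)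
  have "(\<integral>\<^sup>+z. F (fst z, drift_path g (fst z) (snd z) (Suc T)) \<partial>K) =
      (\<integral>\<^sup>+z. F (fst z, (snd z)(Suc T := snd z (Suc T) + ?c z)) * ennreal (?l z) \<partial>K)"
    by (subst Suc.IH[symmetric]) simp_all
  also have "\<dots> = (\<integral>\<^sup>+z. (\<integral>\<^sup>+a. F (fst z, (snd z)(Suc T := a + ?c z)) * ennreal (?l z) \<partial>gauss) \<partial>K)"
    by (subst nn_integral_resample[where k="Suc T"]) (use l c in auto)
  also have "\<dots> = (\<integral>\<^sup>+z. (\<integral>\<^sup>+a. F (fst z, (snd z)(Suc T := a)) * ennreal (?l z) *
      ennreal (exp (?c z * a - (?c z)\<^sup>2 / 2)) \<partial>gauss) \<partial>K)"
  proof (rule nn_integral_cong)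
    fix z assume z: "z \<in> space K"
    then have [measurable]: "(\<lambda>a. F (fst z, (snd z)(Suc T := a)) * ennreal (?l z)) \<in> borel_measurable borel"
      by (auto simp: space_pair_measure)
    show "(\<integral>\<^sup>+a. F (fst z, (snd z)(Suc T := a + ?c z)) * ennreal (?l z) \<partial>gauss) =
        (\<integral>\<^sup>+a. F (fst z, (snd z)(Suc T := a)) * ennreal (?l z) * ennreal (exp (?c z * a - (?c z)\<^sup>2 / 2)) \<partial>gauss)"
      by (rule nn_integral_gauss_shift[where F="\<lambda>a. F (fst z, (snd z)(Suc T := a)) * ennreal (?l z)"]) measurable
  qed
  also have "\<dots> = (\<integral>\<^sup>+z. (\<integral>\<^sup>+a. ?R (fst z, (snd z)(Suc T := a)) \<partial>gauss) \<partial>K)"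
    using l c by simp
  also have "\<dots> = (\<integral>\<^sup>+z. ?R z \<partial>K)"
    by (rule nn_integral_resample[symmetric]) auto
  also have "\<dots> = (\<integral>\<^sup>+z. F z * ennreal (exp (\<Sum>s<Suc T. g s (fst z) (snd z) * snd z (Suc s) - (g s (fst z) (snd z))\<^sup>2 / 2)) \<partial>K)"
    by (intro nn_integral_cong) (simp add: exp_add ennreal_mult mult.assoc)
  finally show ?case .
qed

end

text \<open>All points of the interval have modulus at most
  \<open>\<bar>\<zeta>\<bar> + C + \<eta>\<close>, so the density is at least its value at that
  bound, uniformly in \<open>c\<close>; the interval has length \<open>2 * \<eta>\<close>.\<close>

lemma gauss_interval_lower_bound:
  assumes "\<eta> > 0" "\<bar>c\<bar> \<le> C"
  shows "ennreal (2 * \<eta> * std_normal_density (\<bar>\<zeta>\<bar> + C + \<eta>)) \<le> emeasure gauss {a. \<bar>a + c - \<zeta>\<bar> < \<eta>}"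
proof -
  let ?d = "std_normal_density (\<bar>\<zeta>\<bar> + C + \<eta>)"
  have S: "{a. \<bar>a + c - \<zeta>\<bar> < \<eta>} = {\<zeta> - c - \<eta><..<\<zeta> - c + \<eta>}" by auto
  have "ennreal (2 * \<eta> * ?d) = (\<integral>\<^sup>+a. ennreal ?d * indicator {\<zeta> - c - \<eta><..<\<zeta> - c + \<eta>} a \<partial>lborel)"
    using assms by (subst nn_integral_cmult_indicator) (auto simp: ennreal_mult'[symmetric] mult.commute)
  also have "\<dots> \<le> (\<integral>\<^sup>+a. ennreal (std_normal_density a) * indicator {\<zeta> - c - \<eta><..<\<zeta> - c + \<eta>} a \<partial>lborel)"
  proof (rule nn_integral_mono)
    fix a
    show "ennreal ?d * indicator {\<zeta> - c - \<eta><..<\<zeta> - c + \<eta>} a \<le>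
        ennreal (std_normal_density a) * indicator {\<zeta> - c - \<eta><..<\<zeta> - c + \<eta>} a"
    proof (cases "a \<in> {\<zeta> - c - \<eta><..<\<zeta> - c + \<eta>}")
      case True
      then have "\<bar>a\<bar> \<le> \<bar>\<bar>\<zeta>\<bar> + C + \<eta>\<bar>" using assms by auto
      then have "a\<^sup>2 \<le> (\<bar>\<zeta>\<bar> + C + \<eta>)\<^sup>2" by (simp only: abs_le_square_iff)
      then show ?thesis
        using True by (auto simp: std_normal_density_def intro!: ennreal_leI divide_right_mono)
    qed simp
  qed
  also have "\<dots> = emeasure gauss {a. \<bar>a + c - \<zeta>\<bar> < \<eta>}"
    unfolding S gauss_def by (subst emeasure_density) auto
  finally show ?thesis .
qed

section \<open>Recurring chances for the next output\<close>

context noise_driven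
begin

lemma traj_upd: "s < k \<Longrightarrow> traj g p (v(k := a)) s = traj g p v s"
  unfolding traj_def using path_upd[where g=g, OF drift_adapted] by simp

text \<open>A form of the conditional Borel--Cantelli lemma. If \<open>G T\<close> says that no success occurred in
  \<open>[m, T)\<close>, then \<open>P (G (T+1)) \<le> P (G T) - \<delta> P (G T \<and> A T)\<close>, so \<open>P (G T \<and> A T)\<close> is summable.\<close>

lemma frequently_next_near:
  fixes A :: "nat \<Rightarrow> 'p \<times> (nat \<Rightarrow> real) \<Rightarrow> bool"
  assumes A_meas [measurable]: "\<And>t. Measurable.pred K (A t)"
    and A_upd: "\<And>t p v k a. t < k \<Longrightarrow> A t (p, v(k := a)) = A t (p, v)"
    and bnd: "\<And>t p v. p \<in> space \<rho> \<Longrightarrow> A t (p, v) \<Longrightarrow> \<bar>g t p (traj g p v)\<bar> \<le> C"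
    and \<eta>: "\<eta> > 0"
  shows "AE z in K. (\<exists>\<^sub>\<infinity>t. A t z) \<longrightarrow>
    (\<exists>\<^sub>\<infinity>t. A t z \<and> \<bar>traj g (fst z) (snd z) (Suc t) - \<zeta>\<bar> < \<eta>)"
proof -
  \<comment> \<open>The bound of \<open>gauss_interval_lower_bound\<close>: given the past, if
    \<open>A t\<close> holds, the next output is within \<open>\<eta>\<close> of
    \<open>\<zeta>\<close> with at least this probability.\<close>
  define \<delta> where "\<delta> = 2 * \<eta> * std_normal_density (\<bar>\<zeta>\<bar> + C + \<eta>)"
  have \<delta>: "\<delta> > 0" using \<eta> by (simp add: \<delta>_def normal_density_pos)
  define B where "B t z \<longleftrightarrow> \<bar>traj g (fst z) (snd z) (Suc t) - \<zeta>\<bar> < \<eta>" for t z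
  have [measurable]: "Suc t \<in> {1..}" for t by simp
  have B_meas [measurable]: "Measurable.pred K (B t)" for t
    unfolding B_def using measurable_traj_at[of "Suc t" fst K snd] by measurable
  have B_upd: "B t (p, v(k := a)) = B t (p, v)" if "Suc t < k" for t p v k a
    using that by (simp add: B_def traj_upd)
  have B_Suc: "B t (p, v(Suc t := a)) \<longleftrightarrow> \<bar>a + g t p (traj g p v) - \<zeta>\<bar> < \<eta>" for t p v a
    by (simp add: B_def traj_Suc[where g=g, OF drift_adapted] adapted_traj_upd[where g=g, OF drift_adapted drift_adapted])
  \<comment> \<open>An event \<open>S\<close> inside \<open>A t\<close> that ignores noise
    \<open>Suc t\<close> survives resampling of that noise, so success takes up at least the
    fraction \<open>\<delta>\<close> of it.\<close>
  have step: "\<delta> * measure K {z \<in> space K. S z} \<le> measure K {z \<in> space K. S z \<and> B t z}"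
    if S_meas [measurable]: "Measurable.pred K S" and S_A: "\<And>z. S z \<Longrightarrow> A t z"
      and S_upd: "\<And>p v a. S (p, v(Suc t := a)) = S (p, v)" for S t
  proof -
    have "ennreal \<delta> * emeasure K {z \<in> space K. S z} = (\<integral>\<^sup>+z. ennreal \<delta> * indicator {z \<in> space K. S z} z \<partial>K)"
      by (subst nn_integral_cmult_indicator) auto
    also have "\<dots> \<le> (\<integral>\<^sup>+z. \<integral>\<^sup>+a. indicator {z \<in> space K. S z \<and> B t z} (fst z, (snd z)(Suc t := a)) \<partial>gauss \<partial>K)"
    proof (rule nn_integral_mono)
      fix z assume z: "z \<in> space K"
      show "ennreal \<delta> * indicator {z \<in> space K. S z} z \<le>
        (\<integral>\<^sup>+a. indicator {z \<in> space K. S z \<and> B t z} (fst z, (snd z)(Suc t := a)) \<partial>gauss)"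
      proof (cases "S z")
        case True
        let ?c = "g t (fst z) (traj g (fst z) (snd z))"
        have "fst z \<in> space \<rho>" "snd z \<in> space noise" using z by (auto simp: space_pair_measure)
        then have sp: "(fst z, (snd z)(Suc t := a)) \<in> space K" for a
          by (auto simp: space_pair_measure space_noise PiE_def extensional_def)
        have Sa: "S (fst z, (snd z)(Suc t := a))" for a
          using True by (simp add: S_upd)
        have "(\<integral>\<^sup>+a. indicator {z \<in> space K. S z \<and> B t z} (fst z, (snd z)(Suc t := a)) \<partial>gauss) =
            (\<integral>\<^sup>+a. indicator {a. \<bar>a + ?c - \<zeta>\<bar> < \<eta>} a \<partial>gauss)"
          using sp by (intro nn_integral_cong) (auto simp: indicator_def B_Suc Sa)
        also have "\<dots> = emeasure gauss {a. \<bar>a + ?c - \<zeta>\<bar> < \<eta>}"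
          by (rule nn_integral_indicator) auto
        finally show ?thesis
          using gauss_interval_lower_bound[OF \<eta>, of ?c C \<zeta>] bnd[of "fst z" t "snd z"] S_A[OF True]
            \<open>fst z \<in> space \<rho>\<close> z True
          by (simp add: \<delta>_def)
      qed simp
    qed
    also have "\<dots> = (\<integral>\<^sup>+z. indicator {z \<in> space K. S z \<and> B t z} z \<partial>K)"
      by (rule nn_integral_resample[symmetric]) auto
    also have "\<dots> = emeasure K {z \<in> space K. S z \<and> B t z}"
      by (rule nn_integral_indicator) auto
    finally show ?thesis
      using \<delta> by (simp add: KP.P.emeasure_eq_measure ennreal_mult[symmetric])
  qed
  have fin: "AE z in K. (\<forall>t\<ge>m. \<not> (A t z \<and> B t z)) \<longrightarrow> (\<forall>\<^sub>F t in sequentially. \<not> A t z)" for m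
  proof -
    define G where "G T z \<longleftrightarrow> (\<forall>t\<in>{m..<T}. \<not> (A t z \<and> B t z))" for T z
    have G_meas [measurable]: "Measurable.pred K (G T)" for T unfolding G_def by measurable
    have G_upd: "G T (p, v(k := a)) = G T (p, v)" if "T < k" for T p v k a
      unfolding G_def using that by (intro ball_cong refl) (simp add: A_upd B_upd)
    let ?E = "\<lambda>T. {z \<in> space K. G T z \<and> A T z}"
    have dec: "\<delta> * measure K (?E T) \<le> measure K {z \<in> space K. G T z} - measure K {z \<in> space K. G (Suc T) z}"
      if "T \<ge> m" for T
    proof -
      have "\<delta> * measure K (?E T) \<le> measure K {z \<in> space K. (G T z \<and> A T z) \<and> B T z}"
        by (rule step) (auto simp: A_upd G_upd)
      also have "{z \<in> space K. (G T z \<and> A T z) \<and> B T z} = {z \<in> space K. G T z} - {z \<in> space K. G (Suc T) z}"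
        using that by (auto simp: G_def atLeastLessThanSuc)
      also have "measure K \<dots> = measure K {z \<in> space K. G T z} - measure K {z \<in> space K. G (Suc T) z}"
        by (rule KP.P.finite_measure_Diff) (auto simp: G_def)
      finally show ?thesis .
    qed
    \<comment> \<open>The decrements of the probability of \<open>G T\<close> telescope, which
      bounds the partial sums by \<open>1 / \<delta>\<close>.\<close>
    have "summable (\<lambda>T. measure K (?E (T + m)))"
    proof (rule summableI_nonneg_bounded)
      fix M :: nat
      have "\<delta> * (\<Sum>T<M. measure K (?E (T + m))) \<le>
          (\<Sum>T<M. measure K {z \<in> space K. G (T + m) z} - measure K {z \<in> space K. G (Suc T + m) z})"
        unfolding sum_distrib_left using dec by (intro sum_mono) simp
      also have "\<dots> = measure K {z \<in> space K. G (0 + m) z} - measure K {z \<in> space K. G (M + m) z}"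
        by (subst sum_lessThan_telescope') simp
      also have "\<dots> \<le> 1"
        using KP.P.prob_le_1[of "{z \<in> space K. G (0 + m) z}"] measure_nonneg[of K "{z \<in> space K. G (M + m) z}"] by linarith
      finally show "(\<Sum>T<M. measure K (?E (T + m))) \<le> 1 / \<delta>"
        using \<delta> by (simp add: field_simps)
    qed simp
    then have "AE z in K. \<forall>\<^sub>F T in sequentially. z \<in> space K - ?E (T + m)"
      by (intro borel_cantelli_AE1) (auto simp: less_top[symmetric])
    then show ?thesis
    proof eventually_elim
      case (elim z)
      show ?case
      proof
        assume no: "\<forall>t\<ge>m. \<not> (A t z \<and> B t z)"
        \<comment> \<open>Without success from \<open>m\<close> on, every \<open>G (T + m)\<close>
          holds, so avoiding \<open>?E (T + m)\<close> means that \<open>A (T + m)\<close>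
          fails.\<close>
        have "\<forall>\<^sub>F T in sequentially. \<not> A (T + m) z"
          using elim by eventually_elim (use no in \<open>auto simp: G_def\<close>)
        then show "\<forall>\<^sub>F t in sequentially. \<not> A t z"
          using eventually_sequentially_seg[of "\<lambda>t. \<not> A t z" m] by simp
      qed
    qed
  qed
  then have "AE z in K. \<forall>m. (\<forall>t\<ge>m. \<not> (A t z \<and> B t z)) \<longrightarrow> (\<forall>\<^sub>F t in sequentially. \<not> A t z)"
    by (simp only: AE_all_countable) simp
  then show ?thesis
  proof eventually_elim
    case (elim z)
    then show ?case
      unfolding frequently_def B_def[symmetric] cofinite_eq_sequentially
      by (auto simp: eventually_sequentially)
  qed
qed

end

subsection \<open>Consistency for a Gaussian parameter\<close>

lemma ls_P_cong: "(\<And>s. s < t \<Longrightarrow> \<phi> s = \<psi> s) \<Longrightarrow> ls_P \<phi> t = ls_P \<psi> t"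
  by (induction t) auto

lemma ls_estimate_cong:
  "(\<And>s. s < t \<Longrightarrow> \<phi> s = \<psi> s) \<Longrightarrow> (\<And>s. s < t \<Longrightarrow> y (Suc s) = z (Suc s)) \<Longrightarrow>
    ls_estimate a \<phi> y t = ls_estimate a \<psi> z t"
proof (induction t)
  case (Suc t)
  have "ls_P \<phi> (Suc t) = ls_P \<psi> (Suc t)"
    by (rule ls_P_cong) (use Suc.prems in auto)
  then show ?case
    using Suc by (simp del: ls_P.simps)
qed simp

lemma info_form_cong: "(\<And>s. s < t \<Longrightarrow> \<phi> s = \<psi> s) \<Longrightarrow> info_form \<phi> t u = info_form \<psi> t u"
  by (simp add: info_form_def)

lemma borel_measurable_vecI:
  fixes f :: "'a \<Rightarrow> real ^ 'm::finite"
  assumes "\<And>i. (\<lambda>x. f x $ i) \<in> borel_measurable M"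
  shows "f \<in> borel_measurable M"
proof (subst borel_measurable_euclidean_space, rule ballI)
  fix b :: "real ^ 'm" assume "b \<in> Basis"
  then obtain i where "b = axis i 1" by (auto simp: Basis_vec_def)
  then show "(\<lambda>x. f x \<bullet> b) \<in> borel_measurable M"
    using assms by (simp add: inner_axis)
qed

lemma borel_measurable_ls_P_mult:
  fixes \<phi> :: "nat \<Rightarrow> 'a \<Rightarrow> real ^ 'm::finite"
  assumes [measurable]: "\<And>s. \<phi> s \<in> borel_measurable M" "v \<in> borel_measurable M"
  shows "(\<lambda>x. ls_P (\<lambda>s. \<phi> s x) t *v v x) \<in> borel_measurable M"
  using assms(2)
proof (induction t arbitrary: v)
  case (Suc t)
  note [measurable] = Suc.prems Suc.IH[OF Suc.prems] Suc.IH[OF assms(1)[of t]]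
  show ?case unfolding ls_P_Suc_mult by measurable
qed simp

lemma borel_measurable_ls_estimate:
  fixes \<phi> :: "nat \<Rightarrow> 'a \<Rightarrow> real ^ 'm::finite"
  assumes [measurable]: "\<And>s. \<phi> s \<in> borel_measurable M" "\<And>s. y (Suc s) \<in> borel_measurable M"
  shows "(\<lambda>x. ls_estimate a (\<lambda>s. \<phi> s x) (\<lambda>s. y s x) t) \<in> borel_measurable M"
proof (induction t)
  case (Suc t)
  note [measurable] = Suc.IH borel_measurable_ls_P_mult[of \<phi> M "\<phi> t" "Suc t", OF assms(1,1)]
  show ?case by (simp del: ls_P.simps)
qed simp

text \<open>Used twice on the posterior: \<open>c = -1\<close> gives the reflection about the
  estimate, \<open>c = 2\<close> a dilation about it.\<close>

lemma nn_integral_lborel_affine: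
  fixes f :: "'a::euclidean_space \<Rightarrow> ennreal"
  assumes [measurable]: "f \<in> borel_measurable borel" and "c \<noteq> 0"
  shows "(\<integral>\<^sup>+x. f x \<partial>lborel) = ennreal (\<bar>c\<bar> ^ DIM('a)) * (\<integral>\<^sup>+x. f (t + c *\<^sub>R x) \<partial>lborel)"
  by (subst lborel_affine[OF assms(2), of t])
    (simp add: nn_integral_density nn_integral_distr nn_integral_cmult)

text \<open>The parameter comes from its prior and the regressors are functions of past outputs
  alone, so the log-likelihood is quadratic in \<open>\<theta>\<close>.\<close>

locale gaussian_regression =
  noise_driven "density lborel (\<lambda>x. ennreal (normal_vec_density \<theta>0 x))" "\<lambda>t \<theta> x. \<theta> \<bullet> \<Phi> t x"
  for \<theta>0 :: "real ^ 'm::finite" and \<Phi> :: "nat \<Rightarrow> (nat \<Rightarrow> real) \<Rightarrow> real ^ 'm" +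
  assumes reg_measurable [measurable]: "\<And>t. \<Phi> t \<in> borel_measurable noise"
    and reg_adapted: "adapted \<Phi>"
begin

abbreviation (input) pth :: "(real ^ 'm) \<times> (nat \<Rightarrow> real) \<Rightarrow> nat \<Rightarrow> nat \<Rightarrow> real" where
  "pth z T \<equiv> drift_path (\<lambda>t \<theta> x. \<theta> \<bullet> \<Phi> t x) (fst z) (snd z) T"

abbreviation (input) trj :: "(real ^ 'm) \<times> (nat \<Rightarrow> real) \<Rightarrow> nat \<Rightarrow> real" where
  "trj z \<equiv> traj (\<lambda>t \<theta> x. \<theta> \<bullet> \<Phi> t x) (fst z) (snd z)"

text \<open>Starting at the prior mean makes the estimate the centre of the posterior; other
  starting points are reached through \<open>ls_estimate_restart\<close>.\<close>

definition est :: "nat \<Rightarrow> (nat \<Rightarrow> real) \<Rightarrow> real ^ 'm" where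
  "est t x = ls_estimate \<theta>0 (\<lambda>s. \<Phi> s x) x t"

definition quad :: "nat \<Rightarrow> (nat \<Rightarrow> real) \<Rightarrow> real ^ 'm \<Rightarrow> real" where
  "quad t x u = info_form (\<lambda>s. \<Phi> s x) t u"

definition excited :: "real \<Rightarrow> nat \<Rightarrow> (nat \<Rightarrow> real) \<Rightarrow> bool" where
  "excited \<kappa> t x \<longleftrightarrow> (\<forall>u. \<kappa> * (norm u)\<^sup>2 \<le> quad t x u)"

lemma est_measurable [measurable]: "est t \<in> borel_measurable noise"
  unfolding est_def[abs_def] by (rule borel_measurable_ls_estimate) measurable

lemma quad_measurable [measurable (raw)]:
  assumes [measurable]: "a \<in> measurable M noise" "b \<in> borel_measurable M"
  shows "(\<lambda>x. quad t (a x) (b x)) \<in> borel_measurable M"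
  unfolding quad_def info_form_def by measurable

text \<open>Both sides of the inequality are continuous in \<open>u\<close>, so a countable dense
  set of vectors \<open>u\<close> suffices.\<close>

lemma excited_measurable [measurable]: "Measurable.pred noise (excited \<kappa> t)"
proof -
  obtain D :: "(real ^ 'm) set" where D: "countable D" "\<And>X. open X \<Longrightarrow> X \<noteq> {} \<Longrightarrow> \<exists>d\<in>D. d \<in> X"
    by (metis countable_dense_exists)
  have "closure D = UNIV"
    using D(2)[of "- closure D"] closure_subset[of D] by auto
  moreover have "closed {u. \<kappa> * (norm u)\<^sup>2 \<le> quad t x u}" for x
    unfolding quad_def info_form_def by (intro closed_Collect_le continuous_intros)
  ultimately have "(\<forall>u\<in>D. \<kappa> * (norm u)\<^sup>2 \<le> quad t x u) \<Longrightarrow> excited \<kappa> t x" for x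
    using closure_minimal[of D "{u. \<kappa> * (norm u)\<^sup>2 \<le> quad t x u}"] by (auto simp: excited_def)
  then have "excited \<kappa> t = (\<lambda>x. \<forall>u\<in>D. \<kappa> * (norm u)\<^sup>2 \<le> quad t x u)"
    by (auto simp: excited_def)
  then show ?thesis using D(1) by simp
qed

lemma est_adapted: "adapted est"
  unfolding adapted_def est_def
  by (intro allI impI ls_estimate_cong) (auto intro: adaptedD[OF reg_adapted])

lemma quad_adapted: "adapted quad"
  unfolding adapted_def quad_def
  by (intro allI impI ext info_form_cong) (auto intro: adaptedD[OF reg_adapted])

lemma excited_adapted: "adapted (excited \<kappa>)"
  using quad_adapted unfolding adapted_def excited_def by metis

section \<open>The Gaussian posterior\<close>

definition post_const :: "nat \<Rightarrow> (nat \<Rightarrow> real) \<Rightarrow> real" where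
  "post_const T x = (2 * pi) powr (- (real CARD('m) / 2)) * exp ((quad T x (est T x) - (norm \<theta>0)\<^sup>2) / 2)"

lemma post_const_measurable [measurable]: "post_const T \<in> borel_measurable noise"
  unfolding post_const_def[abs_def] by measurable

text \<open>Completing the square in \<open>\<theta>\<close>: the quadratic part of the exponent is
  given by the information matrix, and the normal equations place the maximum at
  \<open>est T x\<close>. \<open>post_const\<close> collects the factors free of
  \<open>\<theta>\<close>.\<close>

lemma posterior_density:
  "normal_vec_density \<theta>0 \<theta> * exp (\<Sum>s<T. (\<theta> \<bullet> \<Phi> s x) * x (Suc s) - (\<theta> \<bullet> \<Phi> s x)\<^sup>2 / 2) =
    exp (- quad T x (\<theta> - est T x) / 2) * post_const T x"
proof -
  let ?\<phi> = "\<lambda>s. \<Phi> s x"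
  have "\<theta> \<bullet> info_op ?\<phi> T (est T x) = \<theta> \<bullet> \<theta>0 + (\<Sum>s<T. (\<theta> \<bullet> \<Phi> s x) * x (Suc s))"
    unfolding est_def info_op_ls_estimate by (simp add: inner_add_right inner_sum_right mult.commute)
  then have "- (norm (\<theta> - \<theta>0))\<^sup>2 / 2 + (\<Sum>s<T. (\<theta> \<bullet> \<Phi> s x) * x (Suc s) - (\<theta> \<bullet> \<Phi> s x)\<^sup>2 / 2) =
      - quad T x (\<theta> - est T x) / 2 + (quad T x (est T x) - (norm \<theta>0)\<^sup>2) / 2"
    unfolding quad_def info_form_diff info_form_def[of _ _ \<theta>]
    by (simp add: power2_norm_eq_inner inner_diff_left inner_diff_right inner_commute sum_subtractf
        sum_divide_distrib[symmetric] field_simps)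
      (simp add: sum_distrib_left)
  then show ?thesis
    by (simp add: normal_vec_density_def post_const_def exp_add[symmetric] mult_ac)
qed

text \<open>Bayes' formula for the pair of parameter and path: \<open>path_law\<close> supplies the
  likelihood, and Tonelli lets \<open>\<theta>\<close> be integrated first.\<close>

lemma nn_integral_posterior:
  assumes [measurable]: "F \<in> borel_measurable (borel \<Otimes>\<^sub>M noise)"
  shows "(\<integral>\<^sup>+z. F (fst z, pth z T) \<partial>K) =
    (\<integral>\<^sup>+x. (\<integral>\<^sup>+\<theta>. F (\<theta>, x) * ennreal (exp (- quad T x (\<theta> - est T x) / 2)) \<partial>lborel) * ennreal (post_const T x) \<partial>noise)"
proof -
  have [measurable]: "(\<lambda>x. ennreal (normal_vec_density \<theta>0 x)) \<in> borel_measurable borel"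
    unfolding normal_vec_density_def by measurable
  have [measurable]: "Suc s \<in> {1..}" for s by simp
  have [measurable]: "F \<in> borel_measurable K"
    by measurable
  let ?l = "\<lambda>z. exp (\<Sum>s<T. (fst z \<bullet> \<Phi> s (snd z)) * snd z (Suc s) - (fst z \<bullet> \<Phi> s (snd z))\<^sup>2 / 2)"
  have "(\<integral>\<^sup>+z. F (fst z, pth z T) \<partial>K) = (\<integral>\<^sup>+z. F z * ennreal (?l z) \<partial>K)"
    by (rule path_law) measurable
  also have "\<dots> = (\<integral>\<^sup>+x. (\<integral>\<^sup>+\<theta>. F (\<theta>, x) * ennreal (?l (\<theta>, x)) \<partial>density lborel (\<lambda>x. ennreal (normal_vec_density \<theta>0 x))) \<partial>noise)"
    by (subst KP.nn_integral_snd[symmetric]) auto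
  also have "\<dots> = (\<integral>\<^sup>+x. (\<integral>\<^sup>+\<theta>. F (\<theta>, x) * ennreal (exp (- quad T x (\<theta> - est T x) / 2)) \<partial>lborel) * ennreal (post_const T x) \<partial>noise)"
  proof (rule nn_integral_cong)
    fix x assume [measurable]: "x \<in> space noise"
    have [measurable]: "(\<lambda>\<theta>. F (\<theta>, x)) \<in> borel_measurable borel" by measurable
    have "(\<integral>\<^sup>+\<theta>. F (\<theta>, x) * ennreal (?l (\<theta>, x)) \<partial>density lborel (\<lambda>x. ennreal (normal_vec_density \<theta>0 x))) =
        (\<integral>\<^sup>+\<theta>. F (\<theta>, x) * ennreal (normal_vec_density \<theta>0 \<theta> * ?l (\<theta>, x)) \<partial>lborel)"
      by (subst nn_integral_density) (auto simp: ennreal_mult' normal_vec_density_def mult_ac intro!: nn_integral_cong)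
    also have "\<dots> = (\<integral>\<^sup>+\<theta>. F (\<theta>, x) * ennreal (exp (- quad T x (\<theta> - est T x) / 2)) * ennreal (post_const T x) \<partial>lborel)"
      by (simp only: fst_conv snd_conv posterior_density) (simp add: ennreal_mult' mult_ac post_const_def)
    also have "\<dots> = (\<integral>\<^sup>+\<theta>. F (\<theta>, x) * ennreal (exp (- quad T x (\<theta> - est T x) / 2)) \<partial>lborel) * ennreal (post_const T x)"
      by (rule nn_integral_multc) (simp add: quad_def info_form_def)
    finally show "(\<integral>\<^sup>+\<theta>. F (\<theta>, x) * ennreal (?l (\<theta>, x)) \<partial>density lborel (\<lambda>x. ennreal (normal_vec_density \<theta>0 x))) =
        (\<integral>\<^sup>+\<theta>. F (\<theta>, x) * ennreal (exp (- quad T x (\<theta> - est T x) / 2)) \<partial>lborel) * ennreal (post_const T x)" .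
  qed
  finally show ?thesis .
qed

text \<open>Reflection about \<open>est T x\<close> preserves Lebesgue measure and the even function
  \<open>quad T x\<close>, hence the unnormalised posterior, while the path stays fixed.\<close>

lemma nn_integral_reflect:
  assumes [measurable]: "F \<in> borel_measurable (borel \<Otimes>\<^sub>M noise)"
  shows "(\<integral>\<^sup>+z. F (2 *\<^sub>R est T (pth z T) - fst z, pth z T) \<partial>K) = (\<integral>\<^sup>+z. F (fst z, pth z T) \<partial>K)"
proof -
  have "(\<integral>\<^sup>+\<theta>. F (\<theta>, x) * ennreal (exp (- quad T x (\<theta> - est T x) / 2)) \<partial>lborel) =
      (\<integral>\<^sup>+\<theta>. F (2 *\<^sub>R est T x - \<theta>, x) * ennreal (exp (- quad T x (\<theta> - est T x) / 2)) \<partial>lborel)"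
    if [measurable]: "x \<in> space noise" for x
  proof -
    have "2 *\<^sub>R est T x - \<theta> - est T x = - (\<theta> - est T x)" for \<theta>
      by (simp add: scaleR_2)
    then have "quad T x (2 *\<^sub>R est T x - \<theta> - est T x) = quad T x (\<theta> - est T x)" for \<theta>
      unfolding quad_def by (simp only: info_form_minus)
    moreover have "(\<lambda>\<theta>. F (\<theta>, x) * ennreal (exp (- quad T x (\<theta> - est T x) / 2))) \<in> borel_measurable borel"
      by measurable
    ultimately show ?thesis
      by (subst nn_integral_lborel_affine[where c="-1" and t="2 *\<^sub>R est T x"]) simp_all
  qed
  then show ?thesis
    using nn_integral_posterior[of "\<lambda>z. F (2 *\<^sub>R est T (snd z) - fst z, snd z)" T]
      nn_integral_posterior[of F T]
    by (simp cong: nn_integral_cong)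
qed

text \<open>Comparison with a wider Gaussian avoids the normalising determinant:
  \<open>q exp(-q/2)\<close> is at most \<open>3 exp(-q/8)\<close>, and halving the distance to the
  estimate turns the latter into \<open>exp(-q/2)\<close> at the cost of
  \<open>2 ^ CARD('m)\<close>.\<close>

lemma nn_integral_quad_le:
  "(\<integral>\<^sup>+z. ennreal (quad T (pth z T) (fst z - est T (pth z T))) \<partial>K) \<le> ennreal (3 * 2 ^ CARD('m))"
proof -
  have ineq: "q * exp (- q / 2) \<le> 3 * exp (- q / 8)" if "q \<ge> 0" for q :: real
  proof -
    \<comment> \<open>From \<open>exp z \<ge> 1 + z\<close> the right side is at least
      \<open>3 + 9 * q / 8\<close>.\<close>
    have "q \<le> 3 * exp (3 * q / 8)"
      using exp_ge_add_one_self[of "3 * q / 8"] that by linarith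
    then have "q * exp (- q / 2) \<le> 3 * exp (3 * q / 8) * exp (- q / 2)"
      by (rule mult_right_mono) simp
    also have "\<dots> = 3 * exp (- q / 8)"
      by (simp add: exp_add[symmetric] mult.assoc)
    finally show ?thesis .
  qed
  have inner: "(\<integral>\<^sup>+\<theta>. ennreal (quad T x (\<theta> - est T x)) * ennreal (exp (- quad T x (\<theta> - est T x) / 2)) \<partial>lborel)
      \<le> ennreal (3 * 2 ^ CARD('m)) * (\<integral>\<^sup>+\<theta>. 1 * ennreal (exp (- quad T x (\<theta> - est T x) / 2)) \<partial>lborel)"
    if [measurable]: "x \<in> space noise" for x
  proof -
    have q0: "0 \<le> quad T x u" for u by (simp add: quad_def info_form_nonneg)
    have "- est T x + 2 *\<^sub>R \<theta> - est T x = 2 *\<^sub>R (\<theta> - est T x)" for \<theta>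
      by (simp add: scaleR_2)
    then have sc: "quad T x (- est T x + 2 *\<^sub>R \<theta> - est T x) = 4 * quad T x (\<theta> - est T x)" for \<theta>
      unfolding quad_def by (simp only: info_form_scaleR) simp
    have "(\<integral>\<^sup>+\<theta>. ennreal (quad T x (\<theta> - est T x)) * ennreal (exp (- quad T x (\<theta> - est T x) / 2)) \<partial>lborel)
        \<le> (\<integral>\<^sup>+\<theta>. ennreal 3 * ennreal (exp (- quad T x (\<theta> - est T x) / 8)) \<partial>lborel)"
      by (intro nn_integral_mono) (simp only: ennreal_mult'[symmetric] q0 ennreal_leI ineq ennreal_mult''[symmetric] exp_ge_zero)
    also have "\<dots> = ennreal 3 * (\<integral>\<^sup>+\<theta>. ennreal (exp (- quad T x (\<theta> - est T x) / 8)) \<partial>lborel)"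
      by (rule nn_integral_cmult) measurable
    also have "(\<integral>\<^sup>+\<theta>. ennreal (exp (- quad T x (\<theta> - est T x) / 8)) \<partial>lborel) =
        ennreal (2 ^ CARD('m)) * (\<integral>\<^sup>+\<theta>. ennreal (exp (- quad T x (\<theta> - est T x) / 2)) \<partial>lborel)"
      by (subst nn_integral_lborel_affine[where c=2 and t="- est T x"]) (simp_all only: sc, simp_all)
    finally show ?thesis
      by (simp add: ennreal_mult mult.assoc)
  qed
  have "(\<integral>\<^sup>+z. ennreal (quad T (pth z T) (fst z - est T (pth z T))) \<partial>K) =
    (\<integral>\<^sup>+x. (\<integral>\<^sup>+\<theta>. ennreal (quad T x (\<theta> - est T x)) * ennreal (exp (- quad T x (\<theta> - est T x) / 2)) \<partial>lborel) * ennreal (post_const T x) \<partial>noise)"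
    using nn_integral_posterior[of "\<lambda>z. ennreal (quad T (snd z) (fst z - est T (snd z)))" T] by simp
  also have "\<dots> \<le> (\<integral>\<^sup>+x. ennreal (3 * 2 ^ CARD('m)) * ((\<integral>\<^sup>+\<theta>. 1 * ennreal (exp (- quad T x (\<theta> - est T x) / 2)) \<partial>lborel) * ennreal (post_const T x)) \<partial>noise)"
    by (rule nn_integral_mono) (simp only: mult.assoc[symmetric] mult_right_mono inner zero_le)
  also have "\<dots> = ennreal (3 * 2 ^ CARD('m)) * (\<integral>\<^sup>+z. 1 \<partial>K)"
    using nn_integral_posterior[of "\<lambda>z. 1" T] by (subst nn_integral_cmult) auto
  also have "\<dots> = ennreal (3 * 2 ^ CARD('m))"
    by (simp add: KP.P.emeasure_space_1)
  finally show ?thesis .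
qed

section \<open>Deviation bounds and almost sure convergence\<close>

lemma emeasure_excited_error_le:
  assumes "\<kappa> > 0" "\<epsilon> > 0"
  shows "emeasure K {z \<in> space K. excited \<kappa> s (trj z) \<and> \<epsilon> < norm (fst z - est s (trj z))}
    \<le> ennreal (3 * 2 ^ CARD('m) / (\<kappa> * \<epsilon>\<^sup>2))" (is "emeasure K ?S \<le> _")
proof -
  \<comment> \<open>Markov's inequality: on \<open>?S\<close> the quadratic form of the error is at
    least \<open>\<kappa> * \<epsilon>\<^sup>2\<close>.\<close>
  have "ennreal (\<kappa> * \<epsilon>\<^sup>2) * emeasure K ?S = (\<integral>\<^sup>+z. ennreal (\<kappa> * \<epsilon>\<^sup>2) * indicator ?S z \<partial>K)"
    by (rule nn_integral_cmult_indicator[symmetric]) measurable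
  also have "\<dots> \<le> (\<integral>\<^sup>+z. ennreal (quad s (pth z s) (fst z - est s (pth z s))) \<partial>K)"
  proof (rule nn_integral_mono)
    fix z
    show "ennreal (\<kappa> * \<epsilon>\<^sup>2) * indicator ?S z \<le> ennreal (quad s (pth z s) (fst z - est s (pth z s)))"
    proof (cases "z \<in> ?S")
      case True
      then have "\<kappa> * \<epsilon>\<^sup>2 \<le> \<kappa> * (norm (fst z - est s (trj z)))\<^sup>2"
        using assms by (intro mult_left_mono power_mono) auto
      also have "\<dots> \<le> quad s (trj z) (fst z - est s (trj z))"
        using True by (auto simp: excited_def)
      finally show ?thesis
        using True by (simp add: adapted_path[OF est_adapted order_refl] adapted_path[OF quad_adapted order_refl] ennreal_leI)
    qed simp
  qed
  also have "\<dots> \<le> ennreal (3 * 2 ^ CARD('m))"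
    by (rule nn_integral_quad_le)
  finally have "ennreal (\<kappa> * \<epsilon>\<^sup>2 * measure K ?S) \<le> ennreal (3 * 2 ^ CARD('m))"
    using assms by (simp add: KP.P.emeasure_eq_measure ennreal_mult')
  then show ?thesis
    using assms by (auto simp: KP.P.emeasure_eq_measure field_simps intro!: ennreal_leI)
qed

text \<open>A Levy-type maximal inequality: at the first time \<open>k\<close> at which \<open>est k\<close> is far from
  \<open>est s\<close>, the parameter or its reflection about \<open>est k\<close> is far from \<open>est s\<close>, and
  both are equally likely.\<close>

lemma emeasure_excited_max_le:
  "emeasure K {z \<in> space K. excited \<kappa> s (trj z) \<and> (\<exists>k\<ge>s. \<epsilon> < norm (est k (trj z) - est s (trj z)))}
    \<le> 2 * emeasure K {z \<in> space K. excited \<kappa> s (trj z) \<and> \<epsilon> < norm (fst z - est s (trj z))}"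
proof -
  define far where "far k x \<longleftrightarrow> \<epsilon> < norm (est k x - est s x)" for k x
  \<comment> \<open>First passage at time \<open>k\<close>. It is determined by the path up to
    \<open>k\<close>, so reflecting the parameter about \<open>est k\<close> leaves it
    unchanged.\<close>
  define fp where "fp k x \<longleftrightarrow> k \<ge> s \<and> excited \<kappa> s x \<and> far k x \<and> (\<forall>j\<in>{s..<k}. \<not> far j x)" for k x
  have [measurable]: "Measurable.pred noise (far k)" for k unfolding far_def by measurable
  have [measurable]: "Measurable.pred noise (fp k)" for k unfolding fp_def by measurable
  let ?A = "\<lambda>k. {z \<in> space K. fp k (trj z)}"
  let ?B = "\<lambda>k. {z \<in> space K. fp k (trj z) \<and> \<epsilon> < norm (fst z - est s (trj z))}"
  have fp_path: "fp k (pth z k) = fp k (trj z)" for k z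
    unfolding fp_def far_def
    by (auto simp: adapted_path[OF est_adapted] adapted_path[OF excited_adapted])
  have disj: "k = l" if "fp k x" "fp l x" for k l x
    using that unfolding fp_def by (metis atLeastLessThan_iff linorder_neqE_nat)
  have step: "emeasure K (?A k) \<le> 2 * emeasure K (?B k)" for k
  proof (cases "k \<ge> s")
    case True
    let ?F = "\<lambda>z. indicator {z. fp k (snd z) \<and> \<epsilon> < norm (fst z - est s (snd z))} z :: ennreal"
    have Fm [measurable]: "?F \<in> borel_measurable (borel \<Otimes>\<^sub>M noise)" by measurable
    have est_s: "est s (pth z k) = est s (trj z)" for z
      by (rule adapted_path[OF est_adapted True])
    have B: "emeasure K (?B k) = (\<integral>\<^sup>+z. ?F (fst z, pth z k) \<partial>K)"
    proof -
      have "(\<integral>\<^sup>+z. ?F (fst z, pth z k) \<partial>K) = (\<integral>\<^sup>+z. indicator (?B k) z \<partial>K)"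
        by (intro nn_integral_cong) (auto simp: indicator_def fp_path est_s)
      also have "\<dots> = emeasure K (?B k)"
        by (rule nn_integral_indicator) measurable
      finally show ?thesis by simp
    qed
    have "emeasure K (?A k) = (\<integral>\<^sup>+z. indicator (?A k) z \<partial>K)"
      by (rule nn_integral_indicator[symmetric]) measurable
    also have "\<dots> \<le> (\<integral>\<^sup>+z. ?F (fst z, pth z k) + ?F (2 *\<^sub>R est k (pth z k) - fst z, pth z k) \<partial>K)"
    proof (rule nn_integral_mono)
      fix z
      let ?e = "est s (pth z k)" and ?f = "est k (pth z k)"
      show "indicator (?A k) z \<le> ?F (fst z, pth z k) + ?F (2 *\<^sub>R est k (pth z k) - fst z, pth z k)"
      proof (cases "z \<in> ?A k")
        case True
        then have fp: "fp k (pth z k)" by (simp add: fp_path)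
        then have "2 * \<epsilon> < 2 * norm (?f - ?e)" by (simp add: fp_def far_def)
        also have "\<dots> = norm ((fst z - ?e) + (2 *\<^sub>R ?f - fst z - ?e))"
        proof -
          have "(fst z - ?e) + (2 *\<^sub>R ?f - fst z - ?e) = 2 *\<^sub>R (?f - ?e)"
            by (simp add: scaleR_2)
          then show ?thesis by simp
        qed
        also have "\<dots> \<le> norm (fst z - ?e) + norm (2 *\<^sub>R ?f - fst z - ?e)"
          by (rule norm_triangle_ineq)
        finally have "\<epsilon> < norm (fst z - ?e) \<or> \<epsilon> < norm (2 *\<^sub>R ?f - fst z - ?e)" by linarith
        then show ?thesis
          using True fp by (auto simp: indicator_def)
      qed simp
    qed
    also have "\<dots> = (\<integral>\<^sup>+z. ?F (fst z, pth z k) \<partial>K) + (\<integral>\<^sup>+z. ?F (2 *\<^sub>R est k (pth z k) - fst z, pth z k) \<partial>K)"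
      by (rule nn_integral_add) measurable
    also have "\<dots> = 2 * emeasure K (?B k)"
      unfolding nn_integral_reflect[OF Fm] B by (simp add: mult_2)
    finally show ?thesis .
  next
    case False
    then have "?A k = {}" by (auto simp: fp_def)
    then show ?thesis by (simp only: emeasure_empty zero_le)
  qed
  have A_meas: "?A k \<in> sets K" and B_meas: "?B k \<in> sets K" for k
    by measurable
  have D_meas: "{z \<in> space K. excited \<kappa> s (trj z) \<and> \<epsilon> < norm (fst z - est s (trj z))} \<in> sets K"
    by measurable
  have ex: "\<exists>k. fp k x" if exc: "excited \<kappa> s x" and far: "\<exists>k. k \<ge> s \<and> far k x" for x
  proof -
    obtain k where "k \<ge> s \<and> far k x" "\<And>j. j < k \<Longrightarrow> \<not> (j \<ge> s \<and> far j x)"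
      using exists_least_iff[of "\<lambda>k. k \<ge> s \<and> far k x"] far by metis
    then have "fp k x"
      using exc by (auto simp: fp_def)
    then show ?thesis ..
  qed
  have "emeasure K {z \<in> space K. excited \<kappa> s (trj z) \<and> (\<exists>k\<ge>s. \<epsilon> < norm (est k (trj z) - est s (trj z)))}
      \<le> emeasure K (\<Union>k. ?A k)"
    by (rule emeasure_mono) (use A_meas in \<open>auto intro!: ex[unfolded far_def]\<close>)
  also have "\<dots> = (\<Sum>k. emeasure K (?A k))"
    by (rule suminf_emeasure[symmetric]) (use disj A_meas in \<open>auto simp: disjoint_family_on_def\<close>)
  also have "\<dots> \<le> (\<Sum>k. 2 * emeasure K (?B k))"
    by (intro suminf_le step) auto
  also have "\<dots> = 2 * (\<Sum>k. emeasure K (?B k))"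
    by simp
  \<comment> \<open>The \<open>?B k\<close> are disjoint parts of one event about the error at time
    \<open>s\<close>, so summing over all first passage times costs nothing beyond the factor
    \<open>2\<close>.\<close>
  also have "(\<Sum>k. emeasure K (?B k)) = emeasure K (\<Union>k. ?B k)"
    by (rule suminf_emeasure) (use disj B_meas in \<open>auto simp: disjoint_family_on_def\<close>)
  also have "\<dots> \<le> emeasure K {z \<in> space K. excited \<kappa> s (trj z) \<and> \<epsilon> < norm (fst z - est s (trj z))}"
    by (rule emeasure_mono[OF _ D_meas]) (auto simp: fp_def)
  finally show ?thesis
    by (simp add: mult_left_mono)
qed

text \<open>Under excitation \<open>\<kappa>\<close> at time \<open>s\<close>, a deviation at or
  after \<open>s\<close> has probability of order \<open>1 / \<kappa>\<close>. A path that reaches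
  every level \<open>\<kappa>\<close> for good and still strays infinitely often has such deviations
  at all late \<open>s\<close>, for every \<open>\<kappa>\<close>; such paths form a null
  set.\<close>

lemma AE_eventually_close:
  assumes \<epsilon>: "\<epsilon> > 0"
  shows "AE z in K. (\<forall>\<kappa>::nat. \<forall>\<^sub>F t in sequentially. excited (real \<kappa>) t (trj z)) \<longrightarrow>
    (\<forall>\<^sub>F t in sequentially. norm (est t (trj z) - fst z) \<le> 2 * \<epsilon>)"
proof -
  define U where "U \<kappa> s = {z \<in> space K. excited \<kappa> s (trj z) \<and>
      ((\<exists>k\<ge>s. \<epsilon> < norm (est k (trj z) - est s (trj z))) \<or> \<epsilon> < norm (fst z - est s (trj z)))}" for \<kappa> s
  have U_meas [measurable]: "U \<kappa> s \<in> sets K" for \<kappa> s unfolding U_def by measurable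
  \<comment> \<open>The factor \<open>9\<close> is \<open>3 * 3\<close>: the moment bound
    \<open>3 * 2 ^ CARD('m)\<close> enters once for the error at \<open>s\<close> and twice through
    the maximal inequality.\<close>
  define c where "c = 9 * 2 ^ CARD('m) / \<epsilon>\<^sup>2"
  have U_le: "measure K (U \<kappa> s) \<le> c / \<kappa>" if "\<kappa> > 0" for \<kappa> s
  proof -
    let ?D = "{z \<in> space K. excited \<kappa> s (trj z) \<and> \<epsilon> < norm (fst z - est s (trj z))}"
    let ?M = "{z \<in> space K. excited \<kappa> s (trj z) \<and> (\<exists>k\<ge>s. \<epsilon> < norm (est k (trj z) - est s (trj z)))}"
    have D: "measure K ?D \<le> 3 * 2 ^ CARD('m) / (\<kappa> * \<epsilon>\<^sup>2)"
      using emeasure_excited_error_le[OF that \<epsilon>, of s] that \<epsilon>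
      by (simp add: KP.P.emeasure_eq_measure ennreal_le_iff)
    have "ennreal (measure K ?M) \<le> ennreal (2 * measure K ?D)"
      using emeasure_excited_max_le[of \<kappa> s \<epsilon>]
      by (simp add: KP.P.emeasure_eq_measure ennreal_mult)
    then have M: "measure K ?M \<le> 2 * measure K ?D"
      by (simp add: ennreal_le_iff)
    have "U \<kappa> s = ?M \<union> ?D" by (auto simp: U_def)
    then have "measure K (U \<kappa> s) \<le> measure K ?M + measure K ?D"
      by (simp only:) (rule measure_Un_le; measurable)
    also have "\<dots> \<le> 3 * (3 * 2 ^ CARD('m) / (\<kappa> * \<epsilon>\<^sup>2))"
      using M D by linarith
    also have "\<dots> = c / \<kappa>" by (simp add: c_def field_simps)
    finally show ?thesis .
  qed
  \<comment> \<open>A limit inferior over \<open>s\<close>: its measure inherits the bound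
    \<open>c / \<kappa>\<close>, which is the same for all \<open>s\<close>.\<close>
  define W where "W \<kappa> = (\<Union>m. \<Inter>s\<in>{m..}. U \<kappa> s)" for \<kappa>
  have INT [measurable]: "(\<Inter>s\<in>{m..}. U \<kappa> s) \<in> sets K" for \<kappa> m
    by (intro sets.countable_INT') (use U_meas in auto)
  have W_meas [measurable]: "W \<kappa> \<in> sets K" for \<kappa>
    unfolding W_def by measurable
  have W_le: "measure K (W \<kappa>) \<le> c / \<kappa>" if "\<kappa> > 0" for \<kappa>
  proof (rule LIMSEQ_le_const2)
    show "(\<lambda>m. measure K (\<Inter>s\<in>{m..}. U \<kappa> s)) \<longlonglongrightarrow> measure K (W \<kappa>)"
      unfolding W_def
      by (rule KP.P.finite_Lim_measure_incseq) (use INT in \<open>auto simp: incseq_def\<close>)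
    show "\<exists>N. \<forall>n\<ge>N. measure K (\<Inter>s\<in>{n..}. U \<kappa> s) \<le> c / \<kappa>"
    proof (intro exI allI impI)
      fix n :: nat
      have "measure K (\<Inter>s\<in>{n..}. U \<kappa> s) \<le> measure K (U \<kappa> n)"
        by (rule KP.P.finite_measure_mono) (use U_meas in auto)
      then show "measure K (\<Inter>s\<in>{n..}. U \<kappa> s) \<le> c / \<kappa>"
        using U_le[OF that] order_trans by blast
    qed
  qed
  define N where "N = (\<Inter>\<kappa>::nat. W (real \<kappa>))"
  have N [measurable]: "N \<in> sets K" unfolding N_def by measurable
  have N_le: "measure K N \<le> c / real (Suc \<kappa>)" for \<kappa>
  proof -
    have "measure K N \<le> measure K (W (real (Suc \<kappa>)))"
      unfolding N_def by (rule KP.P.finite_measure_mono[OF _ W_meas]) blast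
    then show ?thesis using W_le[of "real (Suc \<kappa>)"] by simp
  qed
  have "(\<lambda>\<kappa>. c / real (Suc \<kappa>)) \<longlonglongrightarrow> 0"
    using LIMSEQ_Suc[OF lim_const_over_n[of c]] by simp
  then have "measure K N \<le> 0"
    by (rule LIMSEQ_le_const) (use N_le in auto)
  then have "N \<in> null_sets K"
    using N by (simp add: null_sets_def KP.P.emeasure_eq_measure measure_le_0_iff)
  then show ?thesis
  proof (rule AE_I')
    show "{z \<in> space K. \<not> ((\<forall>\<kappa>::nat. \<forall>\<^sub>F t in sequentially. excited (real \<kappa>) t (trj z)) \<longrightarrow>
      (\<forall>\<^sub>F t in sequentially. norm (est t (trj z) - fst z) \<le> 2 * \<epsilon>))} \<subseteq> N"
    proof (rule subsetI)
      fix z assume z: "z \<in> {z \<in> space K. \<not> ((\<forall>\<kappa>::nat. \<forall>\<^sub>F t in sequentially. excited (real \<kappa>) t (trj z)) \<longrightarrow>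
        (\<forall>\<^sub>F t in sequentially. norm (est t (trj z) - fst z) \<le> 2 * \<epsilon>))}"
      then have sp: "z \<in> space K"
        and exc: "\<forall>\<kappa>::nat. \<forall>\<^sub>F t in sequentially. excited (real \<kappa>) t (trj z)"
        and far: "\<not> (\<forall>\<^sub>F t in sequentially. norm (est t (trj z) - fst z) \<le> 2 * \<epsilon>)"
        by blast+
      show "z \<in> N"
        unfolding N_def W_def
      proof (rule INT_I)
        fix \<kappa> :: nat
        obtain m where m: "\<And>t. t \<ge> m \<Longrightarrow> excited (real \<kappa>) t (trj z)"
          using exc by (auto simp: eventually_sequentially)
        have "z \<in> U (real \<kappa>) s" if "s \<ge> m" for s
        proof -
          obtain k where k: "k \<ge> s" "2 * \<epsilon> < norm (est k (trj z) - fst z)"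
            using far by (auto simp: eventually_sequentially not_le)
          have "norm (est k (trj z) - fst z) \<le>
              norm (est k (trj z) - est s (trj z)) + norm (fst z - est s (trj z))"
            using norm_triangle_ineq4[of "est k (trj z) - est s (trj z)" "fst z - est s (trj z)"]
            by simp
          then have "\<epsilon> < norm (est k (trj z) - est s (trj z)) \<or> \<epsilon> < norm (fst z - est s (trj z))"
            using k by linarith
          then show ?thesis
            unfolding U_def using sp m[OF that] k(1) by auto
        qed
        then have "z \<in> (\<Inter>s\<in>{m..}. U (real \<kappa>) s)" by auto
        then show "z \<in> (\<Union>m. \<Inter>s\<in>{m..}. U (real \<kappa>) s)" by blast
      qed
    qed
  qed
qed

theorem AE_estimate_consistent:
  "AE z in K. (\<forall>\<kappa>::nat. \<forall>\<^sub>F t in sequentially. excited (real \<kappa>) t (trj z)) \<longrightarrow>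
    (\<lambda>t. est t (trj z)) \<longlonglongrightarrow> fst z"
proof -
  have "AE z in K. \<forall>j::nat. (\<forall>\<kappa>::nat. \<forall>\<^sub>F t in sequentially. excited (real \<kappa>) t (trj z)) \<longrightarrow>
    (\<forall>\<^sub>F t in sequentially. norm (est t (trj z) - fst z) \<le> 2 * (1 / real (Suc j)))"
    unfolding AE_all_countable by (intro allI AE_eventually_close) simp
  then show ?thesis
  proof eventually_elim
    case (elim z)
    show ?case
    proof
      assume "\<forall>\<kappa>::nat. \<forall>\<^sub>F t in sequentially. excited (real \<kappa>) t (trj z)"
      with elim have ev: "\<forall>\<^sub>F t in sequentially. norm (est t (trj z) - fst z) \<le> 2 * (1 / real (Suc j))" for j
        by blast
      show "(\<lambda>t. est t (trj z)) \<longlonglongrightarrow> fst z"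
        unfolding tendsto_iff
      proof (intro allI impI)
        fix e :: real assume "e > 0"
        then obtain j where "inverse (real (Suc j)) < e / 2"
          using reals_Archimedean[of "e / 2"] by auto
        then have j: "2 * (1 / real (Suc j)) < e" by (simp add: inverse_eq_divide)
        show "\<forall>\<^sub>F t in sequentially. dist (est t (trj z)) (fst z) < e"
          using ev[of j] by eventually_elim (use j in \<open>simp add: dist_norm\<close>)
      qed
    qed
  qed
qed

end

subsection \<open>The regressors visit every open set\<close>

locale additive_regressor =
  fixes n :: nat and ms :: "nat \<Rightarrow> nat" and pos :: "'m::finite \<Rightarrow> nat \<times> nat"
    and f :: "nat \<Rightarrow> nat \<Rightarrow> real \<Rightarrow> real"
  assumes pos: "bij_betw pos (UNIV :: 'm set) (block_indices n ms)"
    and f_cont: "\<And>i j. (i, j) \<in> block_indices n ms \<Longrightarrow> continuous_on UNIV (f i j)"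
begin

abbreviation (input) comp :: "'m \<Rightarrow> real \<Rightarrow> real" where
  "comp k \<equiv> f (fst (pos k)) (snd (pos k))"

lemma block_pos: "(fst (pos k), snd (pos k)) \<in> block_indices n ms"
  using bij_betwE[OF pos] by simp

lemma block_mem: "fst (pos k) \<in> {1..n}"
  using block_pos[of k] by (cases "pos k") (simp add: block_indices_def)

lemma comp_cont: "continuous_on UNIV (comp k)"
  by (rule f_cont[OF block_pos])

lemma col_nth: "col pos f z $ k = comp k (z (fst (pos k)))"
  by (simp add: col_def split_beta)

lemma col_cong: "(\<And>i. i \<in> {1..n} \<Longrightarrow> z i = z' i) \<Longrightarrow> col pos f z = col pos f z'"
  using block_mem by (simp add: vec_eq_iff col_nth)

lemma col_measurable:
  assumes "\<And>i. i \<in> {1..n} \<Longrightarrow> (\<lambda>x. z x i) \<in> borel_measurable M"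
  shows "(\<lambda>x. col pos f (z x)) \<in> borel_measurable M"
proof (rule borel_measurable_vecI)
  fix k
  show "(\<lambda>x. col pos f (z x) $ k) \<in> borel_measurable M"
    unfolding col_nth
    using measurable_compose[OF assms[OF block_mem] borel_measurable_continuous_onI[OF comp_cont]] .
qed

lemma col_bounded: "\<exists>C\<ge>0. \<forall>z. (\<forall>i\<in>{1..n}. \<bar>z i\<bar> \<le> R) \<longrightarrow> norm (col pos f z) \<le> C"
proof -
  have "\<exists>C. \<forall>r. \<bar>r\<bar> \<le> R \<longrightarrow> \<bar>comp k r\<bar> \<le> C" for k
  proof -
    have "compact (comp k ` {-R..R})"
      by (intro compact_continuous_image continuous_on_subset[OF comp_cont]) auto
    then obtain C where "\<forall>x\<in>comp k ` {-R..R}. norm x \<le> C"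
      using compact_imp_bounded bounded_iff by blast
    then show ?thesis by (intro exI[of _ C]) (auto simp: abs_le_iff)
  qed
  then obtain C where C: "\<And>k r. \<bar>r\<bar> \<le> R \<Longrightarrow> \<bar>comp k r\<bar> \<le> C k" by metis
  have "norm (col pos f z) \<le> (\<Sum>k\<in>UNIV. \<bar>C k\<bar>)" if "\<forall>i\<in>{1..n}. \<bar>z i\<bar> \<le> R" for z
  proof -
    have "norm (col pos f z) \<le> (\<Sum>k\<in>UNIV. \<bar>col pos f z $ k\<bar>)" by (rule norm_le_l1_cart)
    also have "\<dots> \<le> (\<Sum>k\<in>UNIV. \<bar>C k\<bar>)"
      unfolding col_nth using that block_mem C by (intro sum_mono) (meson abs_ge_self order_trans)
    finally show ?thesis .
  qed
  then show ?thesis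
    by (intro exI[of _ "\<Sum>k\<in>UNIV. \<bar>C k\<bar>"]) (auto simp: sum_nonneg)
qed

section \<open>Finitely many boxes that excite every direction\<close>

lemma col_continuous:
  assumes "\<epsilon> > 0"
  shows "\<exists>\<eta>>0. \<forall>z'. (\<forall>i\<in>{1..n}. \<bar>z' i - z i\<bar> < \<eta>) \<longrightarrow> norm (col pos f z' - col pos f z) \<le> \<epsilon>"
proof -
  let ?\<epsilon> = "\<epsilon> / real CARD('m)"
  have "?\<epsilon> > 0" using assms by simp
  then have "\<exists>\<eta>>0. \<forall>r. \<bar>r - z (fst (pos k))\<bar> < \<eta> \<longrightarrow> \<bar>comp k r - comp k (z (fst (pos k)))\<bar> < ?\<epsilon>" for k
    using comp_cont[of k] unfolding continuous_on_iff dist_real_def by (metis UNIV_I)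
  then obtain \<eta> where \<eta>: "\<And>k. \<eta> k > 0"
    "\<And>k r. \<bar>r - z (fst (pos k))\<bar> < \<eta> k \<Longrightarrow> \<bar>comp k r - comp k (z (fst (pos k)))\<bar> < ?\<epsilon>"
    by metis
  have "norm (col pos f z' - col pos f z) \<le> \<epsilon>" if "\<forall>i\<in>{1..n}. \<bar>z' i - z i\<bar> < Min (range \<eta>)" for z'
  proof -
    have "norm (col pos f z' - col pos f z) \<le> (\<Sum>k\<in>UNIV. \<bar>(col pos f z' - col pos f z) $ k\<bar>)"
      by (rule norm_le_l1_cart)
    also have "\<dots> \<le> (\<Sum>k\<in>(UNIV :: 'm set). ?\<epsilon>)"
    proof (rule sum_mono)
      fix k
      have "\<bar>z' (fst (pos k)) - z (fst (pos k))\<bar> < \<eta> k"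
        using that block_mem[of k] Min_le[of "range \<eta>" "\<eta> k"] by fastforce
      from \<eta>(2)[OF this] show "\<bar>(col pos f z' - col pos f z) $ k\<bar> \<le> ?\<epsilon>"
        by (simp add: col_nth)
    qed
    also have "\<dots> = \<epsilon>" by simp
    finally show ?thesis .
  qed
  then show ?thesis
    using \<eta>(1) by (intro exI[of _ "Min (range \<eta>)"]) auto
qed

text \<open>A nonzero inner product stays away from zero for \<open>z\<close> in a small box and
  directions near \<open>u\<close>; compactness of the unit sphere leaves finitely many boxes. A
  triple holds centre, half-width and lower bound.\<close>

lemma finite_test_boxes:
  assumes span: "\<And>x :: real ^ 'm. norm x = 1 \<Longrightarrow> \<exists>z. col pos f z \<bullet> x \<noteq> 0"
  shows "\<exists>W. finite W \<and> (\<forall>(\<zeta>, \<eta>, \<delta>)\<in>W. \<eta> > 0 \<and> \<delta> > 0) \<and>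
    (\<forall>u. norm u = 1 \<longrightarrow> (\<exists>(\<zeta>, \<eta>, \<delta>)\<in>W. \<forall>z. (\<forall>i\<in>{1..n}. \<bar>z i - \<zeta> i\<bar> < \<eta>) \<longrightarrow> \<delta> \<le> \<bar>col pos f z \<bullet> u\<bar>))"
proof -
  have "\<exists>\<zeta> \<eta> \<delta> r. \<eta> > 0 \<and> \<delta> > 0 \<and> r > 0 \<and>
      (\<forall>u'\<in>ball u r. \<forall>z. (\<forall>i\<in>{1..n}. \<bar>z i - \<zeta> i\<bar> < \<eta>) \<longrightarrow> \<delta> \<le> \<bar>col pos f z \<bullet> u'\<bar>)"
    if u: "norm u = 1" for u
  proof -
    obtain \<zeta> where \<zeta>: "col pos f \<zeta> \<bullet> u \<noteq> 0" using span[OF u] by auto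
    define a where "a = \<bar>col pos f \<zeta> \<bullet> u\<bar>"
    have a: "a > 0" using \<zeta> by (simp add: a_def)
    obtain \<eta> where \<eta>: "\<eta> > 0"
      "\<And>z. (\<forall>i\<in>{1..n}. \<bar>z i - \<zeta> i\<bar> < \<eta>) \<Longrightarrow> norm (col pos f z - col pos f \<zeta>) \<le> a / 4"
      using col_continuous[of "a / 4" \<zeta>] a by auto
    \<comment> \<open>\<open>B\<close> bounds the regressor on the box, and \<open>r\<close> will
      satisfy \<open>B * r = a / 4\<close>. Moving \<open>z\<close> and \<open>u\<close> costs
      \<open>a / 4\<close> each, which leaves \<open>a / 2\<close>.\<close>
    define B where "B = norm (col pos f \<zeta>) + a / 4"
    have B: "B > 0" using a by (simp add: B_def add_nonneg_pos)
    define r where "r = a / (4 * B)"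
    have r: "r > 0" using a B by (simp add: r_def)
    have "a / 2 \<le> \<bar>col pos f z \<bullet> u'\<bar>" if u': "u' \<in> ball u r" and z: "\<forall>i\<in>{1..n}. \<bar>z i - \<zeta> i\<bar> < \<eta>" for u' z
    proof -
      have near: "norm (col pos f z - col pos f \<zeta>) \<le> a / 4" by (rule \<eta>(2)[OF z])
      have nz: "norm (col pos f z) \<le> B"
        using near norm_triangle_ineq2[of "col pos f z" "col pos f \<zeta>"] by (simp add: B_def)
      have "\<bar>(col pos f z - col pos f \<zeta>) \<bullet> u\<bar> \<le> a / 4"
        using Cauchy_Schwarz_ineq2[of "col pos f z - col pos f \<zeta>" u] near u by simp
      moreover have "\<bar>col pos f z \<bullet> (u' - u)\<bar> \<le> a / 4"
      proof -
        have "\<bar>col pos f z \<bullet> (u' - u)\<bar> \<le> norm (col pos f z) * norm (u' - u)"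
          by (rule Cauchy_Schwarz_ineq2)
        also have "\<dots> \<le> B * r"
          using nz u' B by (intro mult_mono) (auto simp: dist_norm norm_minus_commute)
        also have "\<dots> = a / 4" using B by (simp add: r_def)
        finally show ?thesis .
      qed
      moreover have "col pos f z \<bullet> u' = col pos f \<zeta> \<bullet> u + (col pos f z - col pos f \<zeta>) \<bullet> u + col pos f z \<bullet> (u' - u)"
        by (simp add: inner_diff_left inner_diff_right)
      ultimately show ?thesis unfolding a_def by linarith
    qed
    then show ?thesis using \<eta>(1) a r
      by (intro exI[of _ \<zeta>] exI[of _ \<eta>] exI[of _ "a / 2"] exI[of _ r]) auto
  qed
  then obtain \<zeta> \<eta> \<delta> r where *: "\<And>u. norm u = 1 \<Longrightarrow> \<eta> u > 0 \<and> \<delta> u > 0 \<and> r u > 0 \<and>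
      (\<forall>u'\<in>ball u (r u). \<forall>z. (\<forall>i\<in>{1..n}. \<bar>z i - \<zeta> u i\<bar> < \<eta> u) \<longrightarrow> \<delta> u \<le> \<bar>col pos f z \<bullet> u'\<bar>)"
    by metis
  have cover: "sphere 0 1 \<subseteq> (\<Union>u\<in>sphere 0 1. ball u (r u))"
    using * by (fastforce simp: dist_norm)
  obtain D where D: "D \<subseteq> sphere 0 1" "finite D" "sphere 0 1 \<subseteq> (\<Union>u\<in>D. ball u (r u))"
    by (rule compactE_image[OF compact_sphere _ cover]) auto
  let ?W = "(\<lambda>u. (\<zeta> u, \<eta> u, \<delta> u)) ` D"
  have D1: "norm u = 1" if "u \<in> D" for u using D(1) that by auto
  have "\<exists>w\<in>?W. case w of (\<zeta>, \<eta>, \<delta>) \<Rightarrow> \<forall>z. (\<forall>i\<in>{1..n}. \<bar>z i - \<zeta> i\<bar> < \<eta>) \<longrightarrow> \<delta> \<le> \<bar>col pos f z \<bullet> u\<bar>"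
    if "norm u = 1" for u
  proof -
    have "u \<in> sphere 0 1" using that by simp
    then obtain d where d: "d \<in> D" "u \<in> ball d (r d)" using D(3) by blast
    show ?thesis
      by (rule bexI[of _ "(\<zeta> d, \<eta> d, \<delta> d)"]) (use *[OF D1[OF d(1)]] d in auto)
  qed
  moreover have "\<forall>(\<zeta>, \<eta>, \<delta>)\<in>?W. \<eta> > 0 \<and> \<delta> > 0"
    using * D1 by auto
  ultimately show ?thesis
    using D(2) by (intro exI[of _ ?W]) auto
qed

text \<open>Each visit to a box from time \<open>n\<close> on adds at least
  \<open>\<delta>^2\<close> to the form in the unit directions served by that box. With finitely
  many boxes, one time works for all directions.\<close>

lemma info_form_unbounded:
  fixes h :: "nat \<Rightarrow> nat \<Rightarrow> real"
  assumes W: "finite W" "\<forall>(\<zeta>, \<eta>, \<delta>)\<in>W. \<eta> > 0 \<and> (\<delta> :: real) > 0"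
    "\<forall>u. norm u = 1 \<longrightarrow> (\<exists>(\<zeta>, \<eta>, \<delta>)\<in>W. \<forall>z. (\<forall>i\<in>{1..n}. \<bar>z i - \<zeta> i\<bar> < \<eta>) \<longrightarrow> \<delta> \<le> \<bar>col pos f z \<bullet> u\<bar>)"
    and hits: "\<forall>(\<zeta>, \<eta>, \<delta>)\<in>W. \<exists>\<^sub>\<infinity>t. \<forall>i\<in>{1..n}. \<bar>h t i - \<zeta> i\<bar> < \<eta>"
    and \<psi>: "\<And>t. t \<ge> n \<Longrightarrow> \<psi> t = col pos f (h t)"
  shows "\<forall>\<^sub>F t in sequentially. \<forall>u. \<kappa> * (norm u)\<^sup>2 \<le> info_form \<psi> t u"
proof -
  let ?hit = "\<lambda>\<zeta> \<eta> t. \<forall>i\<in>{1..n}. \<bar>h t i - \<zeta> i\<bar> < \<eta>"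
  have "\<forall>w\<in>W. \<forall>\<^sub>F t in sequentially. case w of (\<zeta>, \<eta>, \<delta>) \<Rightarrow>
      \<kappa> \<le> \<delta>\<^sup>2 * real (card {s\<in>{n..<t}. ?hit \<zeta> \<eta> s})"
  proof (rule ballI, clarify)
    fix \<zeta> \<eta> \<delta> assume w: "(\<zeta>, \<eta>, \<delta>) \<in> W"
    then have \<delta>: "\<delta> > 0" using W(2) by auto
    obtain N :: nat where N: "\<kappa> / \<delta>\<^sup>2 \<le> real N" using real_arch_simple by blast
    have "infinite {s. ?hit \<zeta> \<eta> s}" using hits w by (auto simp: INFM_iff_infinite)
    moreover have "{s. ?hit \<zeta> \<eta> s} \<subseteq> {..<n} \<union> {s. s \<ge> n \<and> ?hit \<zeta> \<eta> s}" by auto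
    ultimately have "infinite {s. s \<ge> n \<and> ?hit \<zeta> \<eta> s}"
      using finite_subset by blast
    from infinite_arbitrarily_large[OF this, of N]
    obtain F where F: "F \<subseteq> {s. s \<ge> n \<and> ?hit \<zeta> \<eta> s}" "finite F" "card F = N"
      by (elim exE conjE)
    obtain t0 where t0: "F \<subseteq> {..<t0}" using finite_nat_bounded[OF F(2)] by blast
    have "\<kappa> \<le> \<delta>\<^sup>2 * real (card {s\<in>{n..<t}. ?hit \<zeta> \<eta> s})" if "t \<ge> t0" for t
    proof -
      have "F \<subseteq> {s\<in>{n..<t}. ?hit \<zeta> \<eta> s}" using F(1) t0 that by auto
      then have "N \<le> card {s\<in>{n..<t}. ?hit \<zeta> \<eta> s}"
        using card_mono[of "{s\<in>{n..<t}. ?hit \<zeta> \<eta> s}" F] F(3) by simp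
      then have "\<delta>\<^sup>2 * real N \<le> \<delta>\<^sup>2 * real (card {s\<in>{n..<t}. ?hit \<zeta> \<eta> s})"
        by (intro mult_left_mono) auto
      moreover have "\<kappa> \<le> \<delta>\<^sup>2 * real N" using N \<delta> by (simp add: field_simps)
      ultimately show ?thesis by linarith
    qed
    then show "\<forall>\<^sub>F t in sequentially. \<kappa> \<le> \<delta>\<^sup>2 * real (card {s\<in>{n..<t}. ?hit \<zeta> \<eta> s})"
      unfolding eventually_sequentially by blast
  qed
  then have "\<forall>\<^sub>F t in sequentially. \<forall>w\<in>W. case w of (\<zeta>, \<eta>, \<delta>) \<Rightarrow>
      \<kappa> \<le> \<delta>\<^sup>2 * real (card {s\<in>{n..<t}. ?hit \<zeta> \<eta> s})"
    by (rule eventually_ball_finite[OF W(1)])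
  then show ?thesis
  proof eventually_elim
    case (elim t)
    have unit: "\<kappa> \<le> info_form \<psi> t u" if u: "norm u = 1" for u
    proof -
      obtain \<zeta> \<eta> \<delta> where w: "(\<zeta>, \<eta>, \<delta>) \<in> W"
        "\<And>z. (\<forall>i\<in>{1..n}. \<bar>z i - \<zeta> i\<bar> < \<eta>) \<Longrightarrow> \<delta> \<le> \<bar>col pos f z \<bullet> u\<bar>"
        using W(3) u by fast
      have \<delta>: "\<delta> > 0" using W(2) w(1) by auto
      let ?H = "{s\<in>{n..<t}. ?hit \<zeta> \<eta> s}"
      have "\<kappa> \<le> (\<Sum>s\<in>?H. \<delta>\<^sup>2)" using elim w(1) by (fastforce simp: mult.commute)
      also have "\<dots> \<le> (\<Sum>s\<in>?H. (\<psi> s \<bullet> u)\<^sup>2)"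
      proof (rule sum_mono)
        fix s assume s: "s \<in> ?H"
        then have "\<bar>\<delta>\<bar> \<le> \<bar>\<psi> s \<bullet> u\<bar>" using w(2)[of "h s"] \<delta> by (simp add: \<psi>)
        then show "\<delta>\<^sup>2 \<le> (\<psi> s \<bullet> u)\<^sup>2" by (simp only: abs_le_square_iff)
      qed
      also have "\<dots> \<le> (\<Sum>s<t. (\<psi> s \<bullet> u)\<^sup>2)" by (rule sum_mono2) auto
      also have "\<dots> \<le> info_form \<psi> t u" by (simp add: info_form_def)
      finally show ?thesis .
    qed
    show ?case
    proof
      fix u :: "real ^ 'm"
      show "\<kappa> * (norm u)\<^sup>2 \<le> info_form \<psi> t u"
      proof (cases "u = 0")
        case False
        define e where "e = (1 / norm u) *\<^sub>R u"
        have "norm e = 1" using False by (simp add: e_def)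
        then have "\<kappa> * (norm u)\<^sup>2 \<le> (norm u)\<^sup>2 * info_form \<psi> t e"
          using unit[of e] by (simp add: mult.commute[of _ "(norm u)\<^sup>2"] mult_left_mono)
        also have "\<dots> = info_form \<psi> t (norm u *\<^sub>R e)" by (simp add: info_form_scaleR)
        also have "norm u *\<^sub>R e = u" using False by (simp add: e_def)
        finally show ?thesis .
      qed (simp add: info_form_def)
    qed
  qed
qed

end

text \<open>Time \<open>0\<close> is not a coordinate of the noise space, so the initial output is
  passed separately.\<close>

definition output_at :: "real \<Rightarrow> (nat \<Rightarrow> real) \<Rightarrow> int \<Rightarrow> real" where
  "output_at y0 x s = (if s < 0 then 0 else if s = 0 then y0 else x (nat s))"

lemma output_at_Suc [simp]: "output_at y0 x (int (Suc t)) = x (Suc t)" "output_at y0 x (int t + 1) = x (Suc t)"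
  by (auto simp: output_at_def nat_add_distrib)

lemma output_at_pos: "s > 0 \<Longrightarrow> output_at y0 x s = x (nat s)"
  by (simp add: output_at_def)

lemma output_at_cong: "(\<And>r. int r \<le> s \<Longrightarrow> x r = x' r) \<Longrightarrow> output_at y0 x s = output_at y0 x' s"
  by (auto simp: output_at_def)

lemma output_at_measurable [measurable (raw)]:
  assumes [measurable]: "a \<in> borel_measurable M" "b \<in> measurable M noise"
  shows "(\<lambda>z. output_at (a z) (b z) s) \<in> borel_measurable M"
proof (cases "s > 0")
  case True
  then have [measurable]: "nat s \<in> {1..}" by auto
  show ?thesis using True by (simp add: output_at_pos)
next
  case False
  then show ?thesis by (cases "s = 0") (simp_all add: output_at_def)
qed

section \<open>Recurrence of the output window to arbitrary boxes\<close>

context additive_regressor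
begin

text \<open>The data \<open>p\<close> pairs the parameter with the initial output: these may depend
  on each other but are jointly drawn before the noise.\<close>

definition drift :: "nat \<Rightarrow> (real ^ 'm) \<times> real \<Rightarrow> (nat \<Rightarrow> real) \<Rightarrow> real" where
  "drift t p x = fst p \<bullet> col pos f (lag (output_at (snd p) x) (int t))"

lemma drift_adapted: "adapted (\<lambda>t. drift t p)"
  unfolding adapted_def drift_def
  by (intro allI impI arg_cong2[where f=inner] refl col_cong) (auto simp: lag_def intro!: output_at_cong)

lemma noise_driven_drift:
  assumes "prob_space \<rho>" and [measurable_cong]: "sets \<rho> = sets borel"
  shows "noise_driven \<rho> drift"
proof -
  interpret prob_space \<rho> by fact
  show ?thesis
  proof
    fix t
    have [measurable]: "fst \<in> borel_measurable (borel :: ((real ^ 'm) \<times> real) measure)"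
      "snd \<in> borel_measurable (borel :: ((real ^ 'm) \<times> real) measure)"
      by (simp_all add: borel_prod[symmetric])
    have [measurable]: "(\<lambda>z. col pos f (lag (output_at (snd (fst z)) (snd z)) (int t))) \<in> borel_measurable (\<rho> \<Otimes>\<^sub>M noise)"
      by (rule col_measurable) (simp add: lag_def)
    show "(\<lambda>z. drift t (fst z) (snd z)) \<in> borel_measurable (\<rho> \<Otimes>\<^sub>M noise)"
      unfolding drift_def by measurable
  qed (rule drift_adapted)
qed

text \<open>From a bounded window of outputs, the \<open>n\<close> coordinates of a target are hit one after the other:
  after \<open>k\<close> steps the \<open>k\<close> most recent outputs approximate the last \<open>k\<close> coordinates of \<open>\<zeta>\<close>
  (lag \<open>1\<close> is the most recent output).\<close>

lemma AE_frequently_near: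
  fixes \<rho> :: "((real ^ 'm) \<times> real) measure" and \<zeta> :: "nat \<Rightarrow> real"
  assumes \<rho>: "prob_space \<rho>" "sets \<rho> = sets borel" and \<eta>: "\<eta> > 0"
  defines "L \<equiv> \<lambda>z t. lag (output_at (snd (fst z)) (traj drift (fst z) (snd z))) (int t)"
  shows "AE z in \<rho> \<Otimes>\<^sub>M noise. (\<exists>R. \<exists>\<^sub>\<infinity>t. \<forall>i\<in>{1..n}. \<bar>L z t i\<bar> \<le> R) \<longrightarrow>
    (\<exists>\<^sub>\<infinity>t. \<forall>i\<in>{1..n}. \<bar>L z t i - \<zeta> i\<bar> < \<eta>)"
proof -
  note [measurable_cong] = \<rho>(2)
  interpret noise_driven \<rho> drift by (rule noise_driven_drift[OF \<rho>])
  have [measurable]: "fst \<in> borel_measurable (borel :: ((real ^ 'm) \<times> real) measure)"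
    "snd \<in> borel_measurable (borel :: ((real ^ 'm) \<times> real) measure)"
    by (simp_all add: borel_prod[symmetric])
  have L_meas [measurable]: "(\<lambda>z. L z t i) \<in> borel_measurable K" for t i
    unfolding L_def lag_def by measurable
  have L_upd: "L (p, v(k := a)) t i = L (p, v) t i" if "t < k" "i \<ge> 1" for p v k a t i
    unfolding L_def lag_def using that by (auto intro!: output_at_cong traj_upd)
  have L_Suc: "L z (Suc t) (Suc i) = L z t i" for z t i
    by (simp add: L_def lag_def)
  have L_1: "L z (Suc t) (Suc 0) = traj drift (fst z) (snd z) (Suc t)" for z t
    by (simp add: L_def lag_def)
  \<comment> \<open>The parameter is bounded together with the window, so that the drift is
    uniformly bounded at those times.\<close>
  define bd where "bd R z \<longleftrightarrow> (\<exists>\<^sub>\<infinity>t. norm (fst (fst z)) \<le> R \<and> (\<forall>i\<in>{1..n}. \<bar>L z t i\<bar> \<le> R))" for R z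
  have fixed_R: "AE z in K. bd R z \<longrightarrow> (\<exists>\<^sub>\<infinity>t. \<forall>i\<in>{1..n}. \<bar>L z t i - \<zeta> i\<bar> < \<eta>)"
    if R: "\<And>i. i \<in> {1..n} \<Longrightarrow> \<bar>\<zeta> i\<bar> + \<eta> \<le> R" for R
  proof -
    \<comment> \<open>Besides the \<open>k\<close> matched coordinates, \<open>A k\<close> carries
      the bound on the whole window, which the next step needs. It persists because
      \<open>\<bar>\<zeta> i\<bar> + \<eta> \<le> R\<close> keeps each newly hit output within
      \<open>R\<close>.\<close>
    define A where "A k t z \<longleftrightarrow> norm (fst (fst z)) \<le> R \<and> (\<forall>i\<in>{1..n}. \<bar>L z t i\<bar> \<le> R) \<and>
        (\<forall>i\<in>{1..k}. \<bar>L z t i - \<zeta> (n - k + i)\<bar> < \<eta>)" for k t z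
    have A_meas [measurable]: "Measurable.pred K (A k t)" for k t
      unfolding A_def by measurable
    have A_upd: "A k t (p, v(j := a)) = A k t (p, v)" if "t < j" for k t p v j a
      unfolding A_def using that by (intro conj_cong ball_cong) (auto simp: L_upd)
    obtain C where C: "C \<ge> 0" "\<And>z. (\<forall>i\<in>{1..n}. \<bar>z i\<bar> \<le> R) \<Longrightarrow> norm (col pos f z) \<le> C"
      using col_bounded[of R] by blast
    have A_bnd: "\<bar>drift t p (traj drift p v)\<bar> \<le> R * C" if "A k t (p, v)" for k t p v
    proof -
      have "\<bar>drift t p (traj drift p v)\<bar> \<le> norm (fst p) * norm (col pos f (L (p, v) t))"
        unfolding drift_def L_def by (simp add: Cauchy_Schwarz_ineq2)
      also have "\<dots> \<le> R * C"
        using that C order_trans[OF norm_ge_zero] unfolding A_def by (intro mult_mono) auto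
      finally show ?thesis .
    qed
    have "AE z in K. bd R z \<longrightarrow> (\<exists>\<^sub>\<infinity>t. A k t z)" if "k \<le> n" for k
      using that
    proof (induction k)
      case 0
      then show ?case by (simp add: bd_def A_def)
    next
      case (Suc k)
      \<comment> \<open>The next output aims at \<open>\<zeta> (n - k)\<close>: lags
        \<open>1..k+1\<close> will then match the coordinates \<open>n - k, ..., n\<close>.\<close>
      have "AE z in K. (\<exists>\<^sub>\<infinity>t. A k t z) \<longrightarrow>
          (\<exists>\<^sub>\<infinity>t. A k t z \<and> \<bar>traj drift (fst z) (snd z) (Suc t) - \<zeta> (n - k)\<bar> < \<eta>)"
        by (rule frequently_next_near[where C="R * C"]) (use A_upd A_bnd \<eta> in auto)
      moreover have "AE z in K. bd R z \<longrightarrow> (\<exists>\<^sub>\<infinity>t. A k t z)"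
        using Suc by simp
      ultimately show ?case
      proof eventually_elim
        case (elim z)
        have step: "A (Suc k) (Suc t) z"
          if A: "A k t z" and near: "\<bar>traj drift (fst z) (snd z) (Suc t) - \<zeta> (n - k)\<bar> < \<eta>" for t
          unfolding A_def
        proof (intro conjI ballI)
          show "norm (fst (fst z)) \<le> R" using A by (simp add: A_def)
          fix i assume i: "i \<in> {1..n}"
          show "\<bar>L z (Suc t) i\<bar> \<le> R"
          proof (cases "i = 1")
            case True
            have "\<bar>\<zeta> (n - k)\<bar> + \<eta> \<le> R" using Suc.prems by (intro R) auto
            then show ?thesis using near True by (simp add: L_1)
          next
            case False
            then obtain j where j: "i = Suc j" "j \<in> {1..n}" using i by (cases i) auto
            then show ?thesis using A by (simp add: L_Suc A_def)
          qed
        next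
          fix i assume i: "i \<in> {1..Suc k}"
          show "\<bar>L z (Suc t) i - \<zeta> (n - Suc k + i)\<bar> < \<eta>"
          proof (cases "i = 1")
            case True
            then show ?thesis using near Suc.prems by (simp add: L_1 Suc_diff_Suc)
          next
            case False
            then obtain j where j: "i = Suc j" "j \<in> {1..k}" using i by (cases i) auto
            \<comment> \<open>A matched output ages by one lag while its target coordinate stays the
              same.\<close>
            then have idx: "n - Suc k + i = n - k + j" using Suc.prems by simp
            have "\<bar>L z t j - \<zeta> (n - k + j)\<bar> < \<eta>" using A j(2) unfolding A_def by blast
            then show ?thesis unfolding idx by (simp only: j(1) L_Suc)
          qed
        qed
        show ?case
        proof
          assume "bd R z"
          then have "\<exists>\<^sub>\<infinity>t. A k t z \<and> \<bar>traj drift (fst z) (snd z) (Suc t) - \<zeta> (n - k)\<bar> < \<eta>"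
            using elim by blast
          then show "\<exists>\<^sub>\<infinity>t. A (Suc k) t z"
            unfolding INFM_nat using step by (meson less_SucI)
        qed
      qed
    qed
    from this[OF order_refl] show ?thesis
      by (rule eventually_mono) (auto simp: A_def elim!: frequently_elim1)
  qed
  \<comment> \<open>The sum dominates every \<open>\<bar>\<zeta> i\<bar>\<close>; the countably many
    levels \<open>R0 + m\<close> then exceed any given bound.\<close>
  define R0 where "R0 = (\<Sum>i\<in>{1..n}. \<bar>\<zeta> i\<bar>) + \<eta>"
  have R0: "\<bar>\<zeta> i\<bar> + \<eta> \<le> R0" if "i \<in> {1..n}" for i
    unfolding R0_def using member_le_sum[of i "{1..n}" "\<lambda>i. \<bar>\<zeta> i\<bar>"] that by simp
  have "AE z in K. \<forall>m::nat. bd (R0 + real m) z \<longrightarrow> (\<exists>\<^sub>\<infinity>t. \<forall>i\<in>{1..n}. \<bar>L z t i - \<zeta> i\<bar> < \<eta>)"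
    unfolding AE_all_countable using R0 by (intro allI fixed_R) (simp add: add_increasing2)
  then show ?thesis
  proof eventually_elim
    case (elim z)
    show ?case
    proof
      assume "\<exists>R. \<exists>\<^sub>\<infinity>t. \<forall>i\<in>{1..n}. \<bar>L z t i\<bar> \<le> R"
      then obtain R where freq: "\<exists>\<^sub>\<infinity>t. \<forall>i\<in>{1..n}. \<bar>L z t i\<bar> \<le> R" by blast
      obtain m :: nat where m: "max R (norm (fst (fst z))) - R0 \<le> real m"
        using real_arch_simple by blast
      from freq have "bd (R0 + real m) z"
        unfolding bd_def by (rule frequently_elim1) (use m in fastforce)
      with elim show "\<exists>\<^sub>\<infinity>t. \<forall>i\<in>{1..n}. \<bar>L z t i - \<zeta> i\<bar> < \<eta>" by blast
    qed
  qed
qed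

end

subsection \<open>Strong consistency\<close>

text \<open>Rectangles determine the product measure, and on them independence of the generated
  sigma-algebras is the product rule.\<close>

lemma distr_indep_elements:
  assumes "prob_space M" and indep: "indep_elements M S X T Y"
  shows "distr M (S \<Otimes>\<^sub>M T) (\<lambda>\<omega>. (X \<omega>, Y \<omega>)) = distr M S X \<Otimes>\<^sub>M distr M T Y"
proof -
  interpret prob_space M by fact
  have X [measurable]: "X \<in> measurable M S" and Y [measurable]: "Y \<in> measurable M T"
    and ind: "indep_set (sets (vimage_algebra (space M) X S)) (sets (vimage_algebra (space M) Y T))"
    using indep by (auto simp: indep_elements_def)
  interpret DX: prob_space "distr M S X" by (rule prob_space_distr) measurable
  interpret DY: prob_space "distr M T Y" by (rule prob_space_distr) measurable
  show ?thesis
  proof (rule pair_measure_eqI[symmetric])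
    fix A B assume "A \<in> sets (distr M S X)" "B \<in> sets (distr M T Y)"
    then have [measurable]: "A \<in> sets S" "B \<in> sets T" by auto
    have "prob ((X -` A \<inter> space M) \<inter> (Y -` B \<inter> space M)) = prob (X -` A \<inter> space M) * prob (Y -` B \<inter> space M)"
      by (rule indep_setD[OF ind]) (auto intro: in_vimage_algebra)
    moreover have "(\<lambda>\<omega>. (X \<omega>, Y \<omega>)) -` (A \<times> B) \<inter> space M = (X -` A \<inter> space M) \<inter> (Y -` B \<inter> space M)"
      by auto
    ultimately show "emeasure (distr M S X) A * emeasure (distr M T Y) B =
        emeasure (distr M (S \<Otimes>\<^sub>M T) (\<lambda>\<omega>. (X \<omega>, Y \<omega>))) (A \<times> B)"
      by (simp add: emeasure_distr emeasure_eq_measure ennreal_mult)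
  qed (auto intro: DX.sigma_finite_measure_axioms DY.sigma_finite_measure_axioms)
qed

text \<open>By \<open>path_law\<close> the pair of data and path has a density with respect to
  \<open>K\<close>, so \<open>K\<close>-null sets are null for its law.\<close>

lemma (in noise_driven) AE_path:
  assumes "AE z in K. P z"
  shows "AE z in K. P (fst z, drift_path g (fst z) (snd z) T)"
proof -
  obtain N where N: "{z \<in> space K. \<not> P z} \<subseteq> N" "emeasure K N = 0" "N \<in> sets K"
    using AE_E[OF assms] by blast
  note [measurable] = N(3)
  let ?q = "\<lambda>z. (fst z, drift_path g (fst z) (snd z) T)"
  have q [measurable]: "?q \<in> measurable K K" by measurable
  have "AE z in K. z \<notin> N"
    using N by (intro AE_not_in) (auto simp: null_sets_def)
  then have "(\<integral>\<^sup>+z. indicator N z * ennreal (exp (\<Sum>s<T. g s (fst z) (snd z) * snd z (Suc s) - (g s (fst z) (snd z))\<^sup>2 / 2)) \<partial>K) = (\<integral>\<^sup>+z. 0 \<partial>K)"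
    by (intro nn_integral_cong_AE) (auto elim: eventually_mono)
  then have "(\<integral>\<^sup>+z. indicator N (?q z) \<partial>K) = 0"
    using path_law[of "indicator N" T] by simp
  then have "AE z in K. indicator N (?q z) = (0 :: ennreal)"
    by (subst (asm) nn_integral_0_iff_AE) auto
  then show ?thesis
  proof (rule AE_mp, intro AE_I2 impI)
    fix z assume z: "z \<in> space K" and "indicator N (?q z) = (0 :: ennreal)"
    then have "?q z \<notin> N" by (simp add: indicator_eq_0_iff)
    then show "P (?q z)" using N(1) measurable_space[OF q z] by blast
  qed
qed

text \<open>A drift that is zero before \<open>n\<close> leaves alone the first \<open>n\<close>
  outputs, fed to it in place of noise; from \<open>n\<close> on both recursions take the same
  steps.\<close>

lemma drift_path_restart:
  assumes "\<And>t x. t < n \<Longrightarrow> g' t p' x = 0" "\<And>t x. t \<ge> n \<Longrightarrow> g' t p' x = g t p x"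
  shows "drift_path g' p' (drift_path g p v n) T = drift_path g p v (max n T)"
proof (induction T)
  case (Suc T)
  show ?case
  proof (cases "T < n")
    case True
    then have "max n (Suc T) = max n T" by simp
    then show ?thesis using True Suc by (simp add: assms(1))
  next
    case False
    then show ?thesis using Suc by (simp add: assms(2) max_def Suc_le_eq)
  qed
qed simp

lemma traj_restart:
  assumes "\<And>t x. t < n \<Longrightarrow> g' t p' x = 0" "\<And>t x. t \<ge> n \<Longrightarrow> g' t p' x = g t p x"
  shows "traj g' p' (drift_path g p v n) = traj g p v"
  by (simp add: fun_eq_iff traj_def[of g'] drift_path_restart[of n g' p' g p, OF assms] path_eq_traj)

section \<open>Restarted regression and transfer to the actual system\<close>

context additive_regressor
begin

text \<open>From time \<open>n\<close> on the window holds outputs of positive times only. With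
  earlier regressors set to zero, the regression makes no reference to the initial output.\<close>

definition late_reg :: "nat \<Rightarrow> (nat \<Rightarrow> real) \<Rightarrow> real ^ 'm" where
  "late_reg t x = (if t < n then 0 else col pos f (lag (output_at 0 x) (int t)))"

lemma col_late: "n \<le> t \<Longrightarrow> col pos f (lag (output_at y0 x) (int t)) = late_reg t x"
  unfolding late_reg_def by (auto intro!: col_cong simp: lag_def output_at_pos)

lemma late_reg_adapted: "adapted late_reg"
  unfolding adapted_def late_reg_def
  by (auto intro!: col_cong output_at_cong simp: lag_def)

lemma late_reg_measurable [measurable]: "late_reg t \<in> borel_measurable noise"
proof -
  have "(\<lambda>x. col pos f (lag (output_at 0 x) (int t))) \<in> borel_measurable noise"
    by (rule col_measurable) (simp add: lag_def)
  then show ?thesis by (simp add: late_reg_def[abs_def])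
qed

lemma gaussian_regression_late:
  assumes "prob_space (density lborel (\<lambda>x. ennreal (normal_vec_density \<theta>0 x)))"
  shows "gaussian_regression \<theta>0 late_reg"
proof -
  interpret prob_space "density lborel (\<lambda>x. ennreal (normal_vec_density \<theta>0 x))" by fact
  show ?thesis
    by unfold_locales (auto simp: late_reg_adapted adapted_def intro!: arg_cong2[where f=inner] adaptedD[OF late_reg_adapted])
qed

lemma AE_consistent:
  fixes \<rho> :: "((real ^ 'm) \<times> real) measure" and \<theta>0 b :: "real ^ 'm"
  assumes \<rho>: "prob_space \<rho>" "sets \<rho> = sets borel"
    and prior: "distr \<rho> borel fst = density lborel (\<lambda>x. ennreal (normal_vec_density \<theta>0 x))"
    and span: "\<And>x :: real ^ 'm. norm x = 1 \<Longrightarrow> \<exists>z. col pos f z \<bullet> x \<noteq> 0"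
  defines "Y \<equiv> \<lambda>z. output_at (snd (fst z)) (traj drift (fst z) (snd z))"
  shows "AE z in \<rho> \<Otimes>\<^sub>M noise. (\<exists>R. \<exists>\<^sub>\<infinity>t. \<forall>i\<in>{1..n}. \<bar>lag (Y z) (int t) i\<bar> \<le> R) \<longrightarrow>
    (\<lambda>t. ls_estimate b (\<lambda>s. col pos f (lag (Y z) (int s))) (\<lambda>s. Y z (int s)) t) \<longlonglongrightarrow> fst (fst z)"
proof -
  note [measurable_cong] = \<rho>(2)
  interpret noise_driven \<rho> drift by (rule noise_driven_drift[OF \<rho>])
  have fst_meas [measurable]: "fst \<in> measurable \<rho> borel"
  proof -
    have "fst \<in> borel_measurable (borel :: ((real ^ 'm) \<times> real) measure)"
      by (simp add: borel_prod[symmetric])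
    then show ?thesis by (simp add: measurable_cong_sets[OF \<rho>(2) refl])
  qed
  let ?prior = "density lborel (\<lambda>x. ennreal (normal_vec_density \<theta>0 x))"
  have "prob_space ?prior" unfolding prior[symmetric] by (rule prob_space_distr) measurable
  then interpret C: gaussian_regression \<theta>0 late_reg by (rule gaussian_regression_late)
  \<comment> \<open>Forgetting the initial output maps \<open>K\<close> to the product of prior and
    noise law, so consistency of the late regression pulls back to \<open>K\<close>.\<close>
  have "?prior \<Otimes>\<^sub>M noise = distr \<rho> borel fst \<Otimes>\<^sub>M distr noise noise (\<lambda>x. x)"
    by (simp add: prior)
  also have "\<dots> = distr K (borel \<Otimes>\<^sub>M noise) (\<lambda>(p, v). (fst p, v))"
    by (rule pair_measure_distr) (auto simp: N.sigma_finite_measure_axioms)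
  finally have law: "?prior \<Otimes>\<^sub>M noise = distr K (borel \<Otimes>\<^sub>M noise) (\<lambda>(p, v). (fst p, v))" .
  let ?g = "\<lambda>t \<theta> x. \<theta> \<bullet> late_reg t x"
  have "AE z in K. (\<forall>\<kappa>::nat. \<forall>\<^sub>F t in sequentially. C.excited (real \<kappa>) t (traj ?g (fst (fst z)) (snd z))) \<longrightarrow>
      (\<lambda>t. C.est t (traj ?g (fst (fst z)) (snd z))) \<longlonglongrightarrow> fst (fst z)"
    using AE_distrD[of "\<lambda>(p, v). (fst p, v)" K "borel \<Otimes>\<^sub>M noise", OF _ C.AE_estimate_consistent[unfolded law]]
    by (simp add: case_prod_beta)
  \<comment> \<open>Absolute continuity allows the first \<open>n\<close> noises to be replaced by
    the true outputs; the late regression fed with that sequence reproduces the actual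
    trajectory.\<close>
  from AE_path[OF this, of n]
  have cons: "AE z in K. (\<forall>\<kappa>::nat. \<forall>\<^sub>F t in sequentially. C.excited (real \<kappa>) t (traj drift (fst z) (snd z))) \<longrightarrow>
      (\<lambda>t. C.est t (traj drift (fst z) (snd z))) \<longlonglongrightarrow> fst (fst z)"
  proof eventually_elim
    case (elim z)
    have "traj ?g (fst (fst z)) (drift_path drift (fst z) (snd z) n) = traj drift (fst z) (snd z)"
      by (rule traj_restart) (simp add: late_reg_def, simp add: drift_def col_late)
    with elim show ?case by simp
  qed
  obtain W where W: "finite W" "\<forall>(\<zeta>, \<eta>, \<delta>)\<in>W. \<eta> > 0 \<and> \<delta> > 0"
    "\<forall>u. norm u = 1 \<longrightarrow> (\<exists>(\<zeta>, \<eta>, \<delta>)\<in>W. \<forall>z. (\<forall>i\<in>{1..n}. \<bar>z i - \<zeta> i\<bar> < \<eta>) \<longrightarrow> \<delta> \<le> \<bar>col pos f z \<bullet> u\<bar>)"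
    using finite_test_boxes[OF span] by blast
  have "AE z in K. \<forall>w\<in>W. (\<exists>R. \<exists>\<^sub>\<infinity>t. \<forall>i\<in>{1..n}. \<bar>lag (Y z) (int t) i\<bar> \<le> R) \<longrightarrow>
      (case w of (\<zeta>, \<eta>, \<delta>) \<Rightarrow> \<exists>\<^sub>\<infinity>t. \<forall>i\<in>{1..n}. \<bar>lag (Y z) (int t) i - \<zeta> i\<bar> < \<eta>)"
  proof (rule AE_finite_allI[OF W(1)])
    fix w assume "w \<in> W"
    moreover obtain \<zeta> \<eta> \<delta> where w: "w = (\<zeta>, \<eta>, \<delta>)" by (cases w)
    ultimately have "\<eta> > 0" using W(2) by auto
    from AE_frequently_near[OF \<rho> this, of \<zeta>]
    show "AE z in K. (\<exists>R. \<exists>\<^sub>\<infinity>t. \<forall>i\<in>{1..n}. \<bar>lag (Y z) (int t) i\<bar> \<le> R) \<longrightarrow>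
      (case w of (\<zeta>, \<eta>, \<delta>) \<Rightarrow> \<exists>\<^sub>\<infinity>t. \<forall>i\<in>{1..n}. \<bar>lag (Y z) (int t) i - \<zeta> i\<bar> < \<eta>)"
      by (simp add: w Y_def)
  qed
  with cons show ?thesis
  proof eventually_elim
    case (elim z)
    define x where "x = traj drift (fst z) (snd z)"
    show ?case
    proof
      assume bdd: "\<exists>R. \<exists>\<^sub>\<infinity>t. \<forall>i\<in>{1..n}. \<bar>lag (Y z) (int t) i\<bar> \<le> R"
      have hits: "\<forall>(\<zeta>, \<eta>, \<delta>)\<in>W. \<exists>\<^sub>\<infinity>t. \<forall>i\<in>{1..n}. \<bar>lag (Y z) (int t) i - \<zeta> i\<bar> < \<eta>"
        using elim(2) bdd by blast
      have exc: "\<forall>\<^sub>F t in sequentially. \<forall>u. \<kappa> * (norm u)\<^sup>2 \<le> info_form (\<lambda>s. late_reg s x) t u" for \<kappa>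
        by (rule info_form_unbounded[OF W hits]) (simp add: Y_def x_def col_late)
      then have "\<forall>\<kappa>::nat. \<forall>\<^sub>F t in sequentially. C.excited (real \<kappa>) t x"
        by (simp add: C.excited_def C.quad_def)
      then have "(\<lambda>t. C.est t x) \<longlonglongrightarrow> fst (fst z)"
        using elim(1) by (simp add: x_def)
      moreover have "C.est t x = ls_estimate \<theta>0 (\<lambda>s. late_reg s x) (\<lambda>s. Y z (int s)) t" for t
        unfolding C.est_def by (rule ls_estimate_cong) (simp_all add: Y_def x_def del: of_nat_Suc)
      ultimately have lim: "(\<lambda>t. ls_estimate \<theta>0 (\<lambda>s. late_reg s x) (\<lambda>s. Y z (int s)) t) \<longlonglongrightarrow> fst (fst z)"
        by simp
      \<comment> \<open>Back to the full regression: the early regressors return and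
        \<open>b\<close> replaces \<open>\<theta>0\<close> as initial value.\<close>
      show "(\<lambda>t. ls_estimate b (\<lambda>s. col pos f (lag (Y z) (int s))) (\<lambda>s. Y z (int s)) t) \<longlonglongrightarrow> fst (fst z)"
        by (rule ls_estimate_restart[OF _ _ lim exc, of n]) (simp_all add: Y_def x_def col_late, simp add: late_reg_def)
    qed
  qed
qed

lemma system_eq_traj:
  assumes neg: "\<And>t. t < 0 \<Longrightarrow> y t = 0"
    and step: "\<And>t. y (int t + 1) = \<theta> \<bullet> col pos f (lag y (int t)) + w (t + 1)"
  shows "y = output_at (y 0) (traj drift (\<theta>, y 0) (\<lambda>t\<in>{1..}. w t))"
proof -
  let ?x = "traj drift (\<theta>, y 0) (\<lambda>t\<in>{1..}. w t)"
  \<comment> \<open>Stated for all \<open>s\<close> up to \<open>t\<close>, negative ones included,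
    because the window reaches that far back.\<close>
  have "\<forall>s\<le>int t. y s = output_at (y 0) ?x s" for t
  proof (induction t)
    case 0
    show ?case using neg by (auto simp: output_at_def)
  next
    case (Suc t)
    have "col pos f (lag y (int t)) = col pos f (lag (output_at (y 0) ?x) (int t))"
    proof (rule col_cong)
      fix i assume "i \<in> {1..n}"
      then have "int t - int i + 1 \<le> int t" by simp
      from Suc.IH[rule_format, OF this] show "lag y (int t) i = lag (output_at (y 0) ?x) (int t) i"
        by (simp only: lag_def)
    qed
    then have "y (int t + 1) = ?x (Suc t)"
      by (simp add: step traj_Suc[where g=drift, OF drift_adapted]) (simp add: drift_def)
    then have "y (int t + 1) = output_at (y 0) ?x (int t + 1)" by simp
    then show ?case
      using Suc.IH by (metis of_nat_Suc add.commute zle_add1_eq_le order_le_less)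
  qed
  then show ?thesis
    by (metis ext int_nat_eq linear nle_le order_refl zero_le_imp_eq_int)
qed

end

text \<open>A finite limit inferior bounds the norm along infinitely many \<open>t\<close>. The
  vector \<open>Y_t\<close> is the lag window at time \<open>t + n - 1\<close>, which accounts for
  the time shift.\<close>

lemma frequently_bounded_of_liminf:
  fixes y :: "int \<Rightarrow> real"
  assumes "liminf (\<lambda>t. ereal (L2_set (\<lambda>i. y (int t + int n - int i)) {1..n})) < \<infinity>" and n: "n \<ge> 1"
  shows "\<exists>R. \<exists>\<^sub>\<infinity>t. \<forall>i\<in>{1..n}. \<bar>lag y (int t) i\<bar> \<le> R"
proof -
  let ?X = "\<lambda>t. L2_set (\<lambda>i. y (int t + int n - int i)) {1..n}"
  obtain R where R: "liminf (\<lambda>t. ereal (?X t)) < ereal R"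
    using assms(1) by (metis ereal_dense2)
  have "\<not> (\<forall>\<^sub>F t in sequentially. ereal R \<le> ereal (?X t))"
    using Liminf_bounded[of "ereal R" "\<lambda>t. ereal (?X t)" sequentially] R by auto
  then have freq: "\<exists>\<^sub>F t in sequentially. ?X t < R"
    by (simp add: frequently_def not_less)
  have "\<bar>lag y (int (t + (n - 1))) i\<bar> \<le> R" if "?X t < R" "i \<in> {1..n}" for t i
  proof -
    have "int (t + (n - 1)) - int i + 1 = int t + int n - int i" using n by simp
    then have "\<bar>lag y (int (t + (n - 1))) i\<bar> = \<bar>y (int t + int n - int i)\<bar>"
      by (simp only: lag_def)
    also have "\<dots> \<le> L2_set (\<lambda>i. \<bar>y (int t + int n - int i)\<bar>) {1..n}"
      by (rule member_le_L2_set) (use that in auto)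
    also have "\<dots> = ?X t" by (simp add: L2_set_def)
    finally show ?thesis using that(1) by linarith
  qed
  then have "\<exists>\<^sub>F t in sequentially. \<forall>i\<in>{1..n}. \<bar>lag y (int (t + (n - 1))) i\<bar> \<le> R"
    using freq by (auto elim!: frequently_elim1)
  then have "\<exists>\<^sub>\<infinity>t. \<forall>i\<in>{1..n}. \<bar>lag y (int t) i\<bar> \<le> R"
    using eventually_sequentially_seg[of "\<lambda>t. \<not> (\<forall>i\<in>{1..n}. \<bar>lag y (int t) i\<bar> \<le> R)" "n - 1"]
    unfolding frequently_def cofinite_eq_sequentially by blast
  then show ?thesis ..
qed

theorem corollary2p1:
  fixes M :: "'a measure"
    and n :: nat and ms :: "nat \<Rightarrow> nat"
    and pos :: "'m::finite \<Rightarrow> nat \<times> nat"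
    and f :: "nat \<Rightarrow> nat \<Rightarrow> real \<Rightarrow> real"
    and E :: "nat \<Rightarrow> real set"
    and \<theta>0 \<theta>h0 :: "real ^ 'm"
    and \<theta> :: "'a \<Rightarrow> real ^ 'm"
    and w :: "nat \<Rightarrow> 'a \<Rightarrow> real"
    and y :: "int \<Rightarrow> 'a \<Rightarrow> real"
  assumes prob: "prob_space M"
    and n: "n \<ge> 1"
    and ms: "\<And>i. i \<in> {1..n} \<Longrightarrow> ms i \<ge> 1"
    and pos: "bij_betw pos (UNIV :: 'm set) (block_indices n ms)"
    and f_meas: "\<And>i j. (i, j) \<in> block_indices n ms \<Longrightarrow> f i j \<in> borel_measurable lebesgue"
    \<comment> \<open>Assumption A1\<close>
    and w_indep: "prob_space.indep_vars M (\<lambda>_. borel) w {1..}"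
    and w_ident: "\<And>t. t \<ge> 1 \<Longrightarrow> distr M borel (w t) = distr M borel (w 1)"
    and w_normal: "distributed M lborel (w 1) (\<lambda>x. ennreal (std_normal_density x))"
    and \<theta>_normal: "distributed M lborel \<theta> (\<lambda>x. ennreal (normal_vec_density \<theta>0 x))"
    and \<theta>_indep: "indep_elements M borel \<theta>
           (PiM {1..} (\<lambda>_. borel)) (\<lambda>\<omega>. \<lambda>t\<in>{1..}. w t \<omega>)"
    \<comment> \<open>Assumption A2\<close>
    and E_open: "\<And>i. i \<in> {1..n} \<Longrightarrow> open (E i)"
    and f_cont: "\<And>i j. (i, j) \<in> block_indices n ms \<Longrightarrow> continuous_on UNIV (f i j)"
    and f_Ck: "\<And>i j. (i, j) \<in> block_indices n ms \<Longrightarrow> Ck_on (ms i) (f i j) (E i)"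
    and f_span: "\<And>x :: real ^ 'm. norm x = 1 \<Longrightarrow>
           \<exists>z \<in> (\<Pi>\<^sub>E i\<in>{1..n}. E i). \<bar>col pos f z \<bullet> x\<bar> \<noteq> 0"
    \<comment> \<open>the system and its random initial value, which does not anticipate the noise\<close>
    and y_neg: "\<And>t \<omega>. t < 0 \<Longrightarrow> \<omega> \<in> space M \<Longrightarrow> y t \<omega> = 0"
    and y_init: "indep_elements M borel (\<lambda>\<omega>. (\<theta> \<omega>, y 0 \<omega>))
           (PiM {1..} (\<lambda>_. borel)) (\<lambda>\<omega>. \<lambda>t\<in>{1..}. w t \<omega>)"
    and y_step: "\<And>t \<omega>. \<omega> \<in> space M \<Longrightarrow>
           y (int t + 1) \<omega> = \<theta> \<omega> \<bullet> col pos f (lag (\<lambda>s. y s \<omega>) (int t)) + w (t + 1) \<omega>"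
  shows "AE \<omega> in M.
           liminf (\<lambda>t. ereal (L2_set (\<lambda>i. y (int t + int n - int i) \<omega>) {1..n})) < \<infinity> \<longrightarrow>
           (\<lambda>t. ls_estimate \<theta>h0 (\<lambda>s. col pos f (lag (\<lambda>r. y r \<omega>) (int s)))
                  (\<lambda>s. y (int s) \<omega>) t) \<longlonglongrightarrow> \<theta> \<omega>"
proof -
  interpret prob_space M by fact
  interpret additive_regressor n ms pos f
    by unfold_locales (use pos f_cont in auto)
  let ?w = "\<lambda>\<omega>. \<lambda>t\<in>{1..}. w t \<omega>" and ?p = "\<lambda>\<omega>. (\<theta> \<omega>, y 0 \<omega>)"
  have p_meas [measurable]: "?p \<in> borel_measurable M"
    and w_meas [measurable]: "?w \<in> measurable M (PiM {1..} (\<lambda>_. borel))"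
    using y_init by (auto simp: indep_elements_def)
  define \<rho> where "\<rho> = distr M borel ?p"
  have \<rho>: "prob_space \<rho>" "sets \<rho> = sets borel"
    unfolding \<rho>_def by (auto intro!: prob_space_distr)
  have w_t: "w t \<in> borel_measurable M" if "t \<in> {1..}" for t
    using w_indep that by (auto simp: indep_vars_def)
  have "distr M borel (w 1) = distr M lborel (w 1)"
    by (rule distr_cong) auto
  then have "distr M borel (w 1) = gauss"
    using distributed_distr_eq_density[OF w_normal] by (simp only: gauss_def)
  then have "distr M borel (w t) = gauss" if "t \<in> {1..}" for t
    using w_ident[of t] that by (simp only: atLeast_iff)
  then have "PiM {1..} (\<lambda>t. distr M borel (w t)) = noise"
    unfolding noise_def by (intro PiM_cong refl)
  \<comment> \<open>Independence with standard normal marginals makes the law of the whole noise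
    sequence the product \<open>noise\<close>.\<close>
  then have w_law: "distr M (PiM {1..} (\<lambda>_. borel)) ?w = noise"
    using indep_vars_iff_distr_eq_PiM'[where I="{1..}" and M'="\<lambda>_. borel" and X=w] w_t w_indep
    by simp
  have joint: "distr M (borel \<Otimes>\<^sub>M PiM {1..} (\<lambda>_. borel)) (\<lambda>\<omega>. (?p \<omega>, ?w \<omega>)) = \<rho> \<Otimes>\<^sub>M noise"
    using distr_indep_elements[OF prob y_init] by (simp only: w_law \<rho>_def)
  have fst_meas: "fst \<in> borel_measurable (borel :: ((real ^ 'm) \<times> real) measure)"
    by (simp add: borel_prod[symmetric])
  have "distr \<rho> borel fst = distr M borel \<theta>"
    unfolding \<rho>_def using fst_meas by (subst distr_distr) (auto simp: comp_def)
  also have "\<dots> = density lborel (\<lambda>x. ennreal (normal_vec_density \<theta>0 x))"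
    unfolding distributed_distr_eq_density[OF \<theta>_normal, symmetric] by (rule distr_cong) auto
  finally have prior: "distr \<rho> borel fst = density lborel (\<lambda>x. ennreal (normal_vec_density \<theta>0 x))" .
  have span: "\<exists>z. col pos f z \<bullet> x \<noteq> 0" if "norm x = 1" for x :: "real ^ 'm"
    using f_span[OF that] by auto
  \<comment> \<open>By \<open>joint\<close>, almost sure statements about data and noise on the
    product space pull back to \<open>M\<close>.\<close>
  have "AE \<omega> in M. (\<exists>R. \<exists>\<^sub>\<infinity>t. \<forall>i\<in>{1..n}. \<bar>lag (output_at (y 0 \<omega>) (traj drift (?p \<omega>) (?w \<omega>))) (int t) i\<bar> \<le> R) \<longrightarrow>
    (\<lambda>t. ls_estimate \<theta>h0 (\<lambda>s. col pos f (lag (output_at (y 0 \<omega>) (traj drift (?p \<omega>) (?w \<omega>))) (int s)))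
      (\<lambda>s. output_at (y 0 \<omega>) (traj drift (?p \<omega>) (?w \<omega>)) (int s)) t) \<longlonglongrightarrow> \<theta> \<omega>"
    using AE_distrD[OF measurable_Pair[OF p_meas w_meas] AE_consistent[OF \<rho> prior span, of \<theta>h0, folded joint]] by simp
  then show ?thesis
  proof (rule AE_mp, intro AE_I2 impI)
    fix \<omega> assume \<omega>: "\<omega> \<in> space M"
      and lim: "(\<exists>R. \<exists>\<^sub>\<infinity>t. \<forall>i\<in>{1..n}. \<bar>lag (output_at (y 0 \<omega>) (traj drift (?p \<omega>) (?w \<omega>))) (int t) i\<bar> \<le> R) \<longrightarrow>
        (\<lambda>t. ls_estimate \<theta>h0 (\<lambda>s. col pos f (lag (output_at (y 0 \<omega>) (traj drift (?p \<omega>) (?w \<omega>))) (int s)))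
          (\<lambda>s. output_at (y 0 \<omega>) (traj drift (?p \<omega>) (?w \<omega>)) (int s)) t) \<longlonglongrightarrow> \<theta> \<omega>"
      and bdd: "liminf (\<lambda>t. ereal (L2_set (\<lambda>i. y (int t + int n - int i) \<omega>) {1..n})) < \<infinity>"
    have eq: "(\<lambda>s. y s \<omega>) = output_at (y 0 \<omega>) (traj drift (?p \<omega>) (?w \<omega>))"
      by (rule system_eq_traj[of "\<lambda>s. y s \<omega>"]) (use \<omega> in \<open>auto simp: y_neg y_step\<close>)
    show "(\<lambda>t. ls_estimate \<theta>h0 (\<lambda>s. col pos f (lag (\<lambda>r. y r \<omega>) (int s)))
                  (\<lambda>s. y (int s) \<omega>) t) \<longlonglongrightarrow> \<theta> \<omega>"
      using lim frequently_bounded_of_liminf[OF bdd n] unfolding eq[symmetric] by blast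
  qed
qed

end
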